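(* Let the category $\mathsf{B}$ be additive, $P\colon \mathsf{X}\to\mathsf{B}$ a cartesian monoidal opfibration, and $F\colon \mathsf{B}\to\mathbb{C}\mathsf{at}$ its associated pseudofunctor. Suppose moreover that, for every $X$ in $\mathsf{X}$, the terminal map $\tau_X\colon X\to I_{\mathsf X}$ and the diagonal map $\Delta_X\colon X\to X\times X$ are $P$-cocartesian. Then $F$ factors through $\mathbb{S}\mathsf{ym}2\mathbb{G}\mathsf{p}$.
   Context: A cartesian monoidal opfibration is a (cloven) opfibration $P\colon\mathsf X\to\mathsf B$ such that $\mathsf X$ and $\mathsf B$ have finite products, $P$ strictly preserves them (as a strict monoidal functor), and products of cocartesian arrows are cocartesian. The associated pseudofunctor $F$ sends $A$ to the fibre $F(A)$ of $P$ over $A$ and $f$ to the change-of-base functor $f_*$ determined by cocartesian liftings. $I_{\mathsf X}$ is the terminal object of $\mathsf X$. $F$ is lax symmetric monoidal $(\mathsf B,\times,I_{\mathsf B})\to(\mathbb{C}\mathsf{at},\times,\mathsf I)$ via $R^{A,B}(X,Y)=X\times Y$ and $R^1(\star)=I_{\mathsf X}$, where $\mathsf I$ is the terminal category with object $\star$. Hence, for a commutative monoid $(M,m,e)$ in $\mathsf B$ (in particular for the unique internal abelian group structure on any object of the additive category $\mathsf B$), $F(M)$ is a symmetric monoidal category with tensor $\otimes=F(m)\circ R^{M,M}$ and unit $(F(e)\circ R^1)(\star)$. A symmetric 2-group is a symmetric monoidal groupoid in which every object is weakly invertible with respect to the tensor product; $\mathbb{S}\mathsf{ym}2\mathbb{G}\mathsf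 p$ is the 2-category of symmetric 2-groups. "$F$ factors through $\mathbb{S}\mathsf{ym}2\mathbb{G}\mathsf p$" means that, when each fibre $F(A)$ is given the symmetric monoidal structure with tensor $\otimes=F(m)\circ R^{A,A}$ and unit $(F(e)\circ R^1)(\star)$, where $m\colon A\times A\to A$ and $e\colon I_{\mathsf B}\to A$ are the multiplication and identity of the unique internal abelian group structure on $A$, $F$ is the composite of a pseudofunctor $\mathsf B\to\mathbb{S}\mathsf{ym}2\mathbb{G}\mathsf p$ with the forgetful 2-functor $\mathbb{S}\mathsf{ym}2\mathbb{G}\mathsf p\to\mathbb{C}\mathsf{at}$. *)

theory Defs
  imports "HOL-Algebra.Group"
begin

section \<open>Categories, functors, natural transformations\<close>

text \<open>Categories are given by explicit carriers of objects and arrows. \<open>g \<cdot> f\<close> is ``\<open>g\<close> after \<open>f\<close>'' and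
  is meaningful only if \<open>Cod f = Dom g\<close>.\<close>

record ('o, 'a) cat =
  Ob :: "'o set"
  Ar :: "'a set"
  Dom :: "'a \<Rightarrow> 'o"
  Cod :: "'a \<Rightarrow> 'o"
  Id :: "'o \<Rightarrow> 'a"
  Comp :: "'a \<Rightarrow> 'a \<Rightarrow> 'a" (infixl "\<cdot>\<index>" 70)

definition Hom :: "('o, 'a, 'z) cat_scheme \<Rightarrow> 'o \<Rightarrow> 'o \<Rightarrow> 'a set" where
  "Hom C A B = {f \<in> Ar C. Dom C f = A \<and> Cod C f = B}"

locale category =
  fixes C :: "('o, 'a, 'z) cat_scheme" (structure)
  assumes Dom_in_Ob: "f \<in> Ar C \<Longrightarrow> Dom C f \<in> Ob C"
    and Cod_in_Ob: "f \<in> Ar C \<Longrightarrow> Cod C f \<in> Ob C"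
    and Id_in_Hom: "A \<in> Ob C \<Longrightarrow> Id C A \<in> Hom C A A"
    and Comp_in_Hom: "\<lbrakk>f \<in> Hom C X Y; g \<in> Hom C Y Z\<rbrakk> \<Longrightarrow> g \<cdot> f \<in> Hom C X Z"
    and Comp_Id: "f \<in> Ar C \<Longrightarrow> f \<cdot> Id C (Dom C f) = f"
    and Id_Comp: "f \<in> Ar C \<Longrightarrow> Id C (Cod C f) \<cdot> f = f"
    and Comp_assoc: "\<lbrakk>f \<in> Hom C W X; g \<in> Hom C X Y; h \<in> Hom C Y Z\<rbrakk> \<Longrightarrow> (h \<cdot> g) \<cdot> f = h \<cdot> (g \<cdot> f)"

definition is_iso :: "('o, 'a, 'z) cat_scheme \<Rightarrow> 'a \<Rightarrow> bool" where
  "is_iso C f \<longleftrightarrow> f \<in> Ar C \<and>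
     (\<exists>g \<in> Hom C (Cod C f) (Dom C f). g \<cdot>\<^bsub>C\<^esub> f = Id C (Dom C f) \<and> f \<cdot>\<^bsub>C\<^esub> g = Id C (Cod C f))"

definition isomorphic :: "('o, 'a, 'z) cat_scheme \<Rightarrow> 'o \<Rightarrow> 'o \<Rightarrow> bool" where
  "isomorphic C A B \<longleftrightarrow> (\<exists>f \<in> Hom C A B. is_iso C f)"

definition prod_cat :: "('o, 'a, 'z) cat_scheme \<Rightarrow> ('p, 'b, 'y) cat_scheme \<Rightarrow> ('o \<times> 'p, 'a \<times> 'b) cat" where
  "prod_cat C D =
     \<lparr>Ob = Ob C \<times> Ob D, Ar = Ar C \<times> Ar D,
      Dom = map_prod (Dom C) (Dom D), Cod = map_prod (Cod C) (Cod D),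
      Id = map_prod (Id C) (Id D),
      Comp = (\<lambda>g f. (fst g \<cdot>\<^bsub>C\<^esub> fst f, snd g \<cdot>\<^bsub>D\<^esub> snd f))\<rparr>"

record ('o, 'a, 'p, 'b) functor_data =
  FO :: "'o \<Rightarrow> 'p"
  FA :: "'a \<Rightarrow> 'b"

definition is_functor ::
  "('o, 'a, 'z) cat_scheme \<Rightarrow> ('p, 'b, 'y) cat_scheme \<Rightarrow> ('o, 'a, 'p, 'b, 'x) functor_data_scheme \<Rightarrow> bool" where
  "is_functor C D F \<longleftrightarrow>
     (\<forall>A \<in> Ob C. FO F A \<in> Ob D) \<and>
     (\<forall>f \<in> Ar C. FA F f \<in> Hom D (FO F (Dom C f)) (FO F (Cod C f))) \<and>
     (\<forall>A \<in> Ob C. FA F (Id C A) = Id D (FO F A)) \<and>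
     (\<forall>f \<in> Ar C. \<forall>g \<in> Ar C. Cod C f = Dom C g \<longrightarrow> FA F (g \<cdot>\<^bsub>C\<^esub> f) = FA F g \<cdot>\<^bsub>D\<^esub> FA F f)"

definition id_functor :: "('o, 'a, 'o, 'a) functor_data" where
  "id_functor = \<lparr>FO = \<lambda>X. X, FA = \<lambda>f. f\<rparr>"

definition comp_functor ::
  "('p, 'b, 'q, 'c, 'y) functor_data_scheme \<Rightarrow> ('o, 'a, 'p, 'b, 'x) functor_data_scheme
     \<Rightarrow> ('o, 'a, 'q, 'c) functor_data" where
  "comp_functor G F = \<lparr>FO = \<lambda>X. FO G (FO F X), FA = \<lambda>f. FA G (FA F f)\<rparr>"

definition nat_trans ::
  "('o, 'a, 'z) cat_scheme \<Rightarrow> ('p, 'b, 'y) cat_scheme \<Rightarrow> ('o, 'a, 'p, 'b, 'x) functor_data_scheme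
     \<Rightarrow> ('o, 'a, 'p, 'b, 'w) functor_data_scheme \<Rightarrow> ('o \<Rightarrow> 'b) \<Rightarrow> bool" where
  "nat_trans C D F G t \<longleftrightarrow>
     (\<forall>X \<in> Ob C. t X \<in> Hom D (FO F X) (FO G X)) \<and>
     (\<forall>f \<in> Ar C. t (Cod C f) \<cdot>\<^bsub>D\<^esub> FA F f = FA G f \<cdot>\<^bsub>D\<^esub> t (Dom C f))"

definition nat_iso ::
  "('o, 'a, 'z) cat_scheme \<Rightarrow> ('p, 'b, 'y) cat_scheme \<Rightarrow> ('o, 'a, 'p, 'b, 'x) functor_data_scheme
     \<Rightarrow> ('o, 'a, 'p, 'b, 'w) functor_data_scheme \<Rightarrow> ('o \<Rightarrow> 'b) \<Rightarrow> bool" where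
  "nat_iso C D F G t \<longleftrightarrow> nat_trans C D F G t \<and> (\<forall>X \<in> Ob C. is_iso D (t X))"


section \<open>Categories with chosen finite products\<close>

record ('o, 'a) fp_cat = "('o, 'a) cat" +
  One :: "'o"
  Prd :: "'o \<Rightarrow> 'o \<Rightarrow> 'o"
  pr1 :: "'o \<Rightarrow> 'o \<Rightarrow> 'a"
  pr2 :: "'o \<Rightarrow> 'o \<Rightarrow> 'a"

locale finite_product_category = category C
  for C :: "('o, 'a, 'z) fp_cat_scheme" (structure) +
  assumes One_in_Ob: "One C \<in> Ob C"
    and One_terminal: "A \<in> Ob C \<Longrightarrow> \<exists>!f. f \<in> Hom C A (One C)"
    and Prd_in_Ob: "\<lbrakk>A \<in> Ob C; B \<in> Ob C\<rbrakk> \<Longrightarrow> Prd C A B \<in> Ob C"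
    and pr1_in_Hom: "\<lbrakk>A \<in> Ob C; B \<in> Ob C\<rbrakk> \<Longrightarrow> pr1 C A B \<in> Hom C (Prd C A B) A"
    and pr2_in_Hom: "\<lbrakk>A \<in> Ob C; B \<in> Ob C\<rbrakk> \<Longrightarrow> pr2 C A B \<in> Hom C (Prd C A B) B"
    and Prd_universal: "\<lbrakk>f \<in> Hom C Z A; g \<in> Hom C Z B\<rbrakk> \<Longrightarrow>
          \<exists>!h. h \<in> Hom C Z (Prd C A B) \<and> pr1 C A B \<cdot> h = f \<and> pr2 C A B \<cdot> h = g"

definition terminal_map :: "('o, 'a, 'z) fp_cat_scheme \<Rightarrow> 'o \<Rightarrow> 'a" where
  "terminal_map C A = (THE f. f \<in> Hom C A (One C))"

definition pair_arr :: "('o, 'a, 'z) fp_cat_scheme \<Rightarrow> 'a \<Rightarrow> 'a \<Rightarrow> 'a" where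
  "pair_arr C f g = (THE h. h \<in> Hom C (Dom C f) (Prd C (Cod C f) (Cod C g)) \<and>
     pr1 C (Cod C f) (Cod C g) \<cdot>\<^bsub>C\<^esub> h = f \<and> pr2 C (Cod C f) (Cod C g) \<cdot>\<^bsub>C\<^esub> h = g)"

definition diagonal_map :: "('o, 'a, 'z) fp_cat_scheme \<Rightarrow> 'o \<Rightarrow> 'a" where
  "diagonal_map C A = pair_arr C (Id C A) (Id C A)"

definition prod_arr :: "('o, 'a, 'z) fp_cat_scheme \<Rightarrow> 'a \<Rightarrow> 'a \<Rightarrow> 'a" where
  "prod_arr C f g = pair_arr C (f \<cdot>\<^bsub>C\<^esub> pr1 C (Dom C f) (Dom C g)) (g \<cdot>\<^bsub>C\<^esub> pr2 C (Dom C f) (Dom C g))"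

definition prod_assoc :: "('o, 'a, 'z) fp_cat_scheme \<Rightarrow> 'o \<Rightarrow> 'o \<Rightarrow> 'o \<Rightarrow> 'a" where
  "prod_assoc C A B D = pair_arr C
     (pr1 C A B \<cdot>\<^bsub>C\<^esub> pr1 C (Prd C A B) D)
     (pair_arr C (pr2 C A B \<cdot>\<^bsub>C\<^esub> pr1 C (Prd C A B) D) (pr2 C (Prd C A B) D))"

definition prod_swap :: "('o, 'a, 'z) fp_cat_scheme \<Rightarrow> 'o \<Rightarrow> 'o \<Rightarrow> 'a" where
  "prod_swap C A B = pair_arr C (pr2 C A B) (pr1 C A B)"

definition internal_abelian_group ::
  "('o, 'a, 'z) fp_cat_scheme \<Rightarrow> 'o \<Rightarrow> 'a \<Rightarrow> 'a \<Rightarrow> 'a \<Rightarrow> bool" where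
  "internal_abelian_group C A m e i \<longleftrightarrow>
     A \<in> Ob C \<and> m \<in> Hom C (Prd C A A) A \<and> e \<in> Hom C (One C) A \<and> i \<in> Hom C A A \<and>
     m \<cdot>\<^bsub>C\<^esub> prod_arr C m (Id C A) = m \<cdot>\<^bsub>C\<^esub> prod_arr C (Id C A) m \<cdot>\<^bsub>C\<^esub> prod_assoc C A A A \<and>
     m \<cdot>\<^bsub>C\<^esub> prod_arr C e (Id C A) = pr2 C (One C) A \<and>
     m \<cdot>\<^bsub>C\<^esub> prod_arr C (Id C A) e = pr1 C A (One C) \<and>
     m \<cdot>\<^bsub>C\<^esub> pair_arr C i (Id C A) = e \<cdot>\<^bsub>C\<^esub> terminal_map C A \<and>
     m \<cdot>\<^bsub>C\<^esub> pair_arr C (Id C A) i = e \<cdot>\<^bsub>C\<^esub> terminal_map C A \<and>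
     m \<cdot>\<^bsub>C\<^esub> prod_swap C A A = m"

text \<open>Intended for additive categories, where the internal abelian group structure on an object is unique.\<close>

definition add_mult :: "('o, 'a, 'z) fp_cat_scheme \<Rightarrow> 'o \<Rightarrow> 'a" where
  "add_mult C A = (THE m. \<exists>e i. internal_abelian_group C A m e i)"

definition add_unit :: "('o, 'a, 'z) fp_cat_scheme \<Rightarrow> 'o \<Rightarrow> 'a" where
  "add_unit C A = (THE e. \<exists>m i. internal_abelian_group C A m e i)"


section \<open>Additive categories\<close>

text \<open>\<open>ab A B\<close> is the abelian group structure on \<open>Hom C A B\<close>, written multiplicatively
  (\<open>\<otimes>\<close>, \<open>\<one>\<close>) as in HOL-Algebra.\<close>

definition preadditive_structure ::
  "('o, 'a, 'z) cat_scheme \<Rightarrow> ('o \<Rightarrow> 'o \<Rightarrow> 'a monoid) \<Rightarrow> bool" where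
  "preadditive_structure C ab \<longleftrightarrow>
     (\<forall>A \<in> Ob C. \<forall>B \<in> Ob C. comm_group (ab A B) \<and> carrier (ab A B) = Hom C A B) \<and>
     (\<forall>A \<in> Ob C. \<forall>B \<in> Ob C. \<forall>D \<in> Ob C. \<forall>f \<in> Hom C A B. \<forall>g \<in> Hom C A B. \<forall>h \<in> Hom C B D.
        h \<cdot>\<^bsub>C\<^esub> (f \<otimes>\<^bsub>ab A B\<^esub> g) = (h \<cdot>\<^bsub>C\<^esub> f) \<otimes>\<^bsub>ab A D\<^esub> (h \<cdot>\<^bsub>C\<^esub> g)) \<and>
     (\<forall>A \<in> Ob C. \<forall>B \<in> Ob C. \<forall>D \<in> Ob C. \<forall>f \<in> Hom C B D. \<forall>g \<in> Hom C B D. \<forall>h \<in> Hom C A B.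
        (f \<otimes>\<^bsub>ab B D\<^esub> g) \<cdot>\<^bsub>C\<^esub> h = (f \<cdot>\<^bsub>C\<^esub> h) \<otimes>\<^bsub>ab A D\<^esub> (g \<cdot>\<^bsub>C\<^esub> h))"

definition has_zero_object :: "('o, 'a, 'z) cat_scheme \<Rightarrow> bool" where
  "has_zero_object C \<longleftrightarrow>
     (\<exists>Z \<in> Ob C. \<forall>A \<in> Ob C. (\<exists>!f. f \<in> Hom C A Z) \<and> (\<exists>!f. f \<in> Hom C Z A))"

definition has_binary_biproducts ::
  "('o, 'a, 'z) cat_scheme \<Rightarrow> ('o \<Rightarrow> 'o \<Rightarrow> 'a monoid) \<Rightarrow> bool" where
  "has_binary_biproducts C ab \<longleftrightarrow>
     (\<forall>A \<in> Ob C. \<forall>B \<in> Ob C. \<exists>S \<in> Ob C.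
        \<exists>p1 \<in> Hom C S A. \<exists>p2 \<in> Hom C S B. \<exists>i1 \<in> Hom C A S. \<exists>i2 \<in> Hom C B S.
          p1 \<cdot>\<^bsub>C\<^esub> i1 = Id C A \<and> p2 \<cdot>\<^bsub>C\<^esub> i2 = Id C B \<and>
          (i1 \<cdot>\<^bsub>C\<^esub> p1) \<otimes>\<^bsub>ab S S\<^esub> (i2 \<cdot>\<^bsub>C\<^esub> p2) = Id C S)"

definition additive_category :: "('o, 'a, 'z) cat_scheme \<Rightarrow> bool" where
  "additive_category C \<longleftrightarrow> category C \<and> has_zero_object C \<and>
     (\<exists>ab. preadditive_structure C ab \<and> has_binary_biproducts C ab)"


section \<open>Symmetric 2-groups\<close>

record ('o, 'a) sm_cat = "('o, 'a) cat" +
  Ten :: "('o \<times> 'o, 'a \<times> 'a, 'o, 'a) functor_data"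
  Unt :: "'o"
  Asc :: "'o \<Rightarrow> 'o \<Rightarrow> 'o \<Rightarrow> 'a"
  LUn :: "'o \<Rightarrow> 'a"
  RUn :: "'o \<Rightarrow> 'a"
  Sym :: "'o \<Rightarrow> 'o \<Rightarrow> 'a"

abbreviation tenO :: "('o, 'a, 'z) sm_cat_scheme \<Rightarrow> 'o \<Rightarrow> 'o \<Rightarrow> 'o" where
  "tenO M X Y \<equiv> FO (Ten M) (X, Y)"

abbreviation tenA :: "('o, 'a, 'z) sm_cat_scheme \<Rightarrow> 'a \<Rightarrow> 'a \<Rightarrow> 'a" where
  "tenA M f g \<equiv> FA (Ten M) (f, g)"

locale symmetric_monoidal_category = category M
  for M :: "('o, 'a, 'z) sm_cat_scheme" (structure) +
  assumes Ten_functor: "is_functor (prod_cat M M) M (Ten M)"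
    and Unt_in_Ob: "Unt M \<in> Ob M"
    and Asc_in_Hom: "\<lbrakk>X \<in> Ob M; Y \<in> Ob M; Z \<in> Ob M\<rbrakk> \<Longrightarrow>
          Asc M X Y Z \<in> Hom M (tenO M (tenO M X Y) Z) (tenO M X (tenO M Y Z))"
    and Asc_iso: "\<lbrakk>X \<in> Ob M; Y \<in> Ob M; Z \<in> Ob M\<rbrakk> \<Longrightarrow> is_iso M (Asc M X Y Z)"
    and Asc_natural: "\<lbrakk>f \<in> Hom M X X'; g \<in> Hom M Y Y'; h \<in> Hom M Z Z'\<rbrakk> \<Longrightarrow>
          Asc M X' Y' Z' \<cdot> tenA M (tenA M f g) h = tenA M f (tenA M g h) \<cdot> Asc M X Y Z"
    and LUn_in_Hom: "X \<in> Ob M \<Longrightarrow> LUn M X \<in> Hom M (tenO M (Unt M) X) X"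
    and LUn_iso: "X \<in> Ob M \<Longrightarrow> is_iso M (LUn M X)"
    and LUn_natural: "f \<in> Hom M X X' \<Longrightarrow> LUn M X' \<cdot> tenA M (Id M (Unt M)) f = f \<cdot> LUn M X"
    and RUn_in_Hom: "X \<in> Ob M \<Longrightarrow> RUn M X \<in> Hom M (tenO M X (Unt M)) X"
    and RUn_iso: "X \<in> Ob M \<Longrightarrow> is_iso M (RUn M X)"
    and RUn_natural: "f \<in> Hom M X X' \<Longrightarrow> RUn M X' \<cdot> tenA M f (Id M (Unt M)) = f \<cdot> RUn M X"
    and Sym_in_Hom: "\<lbrakk>X \<in> Ob M; Y \<in> Ob M\<rbrakk> \<Longrightarrow> Sym M X Y \<in> Hom M (tenO M X Y) (tenO M Y X)"
    and Sym_natural: "\<lbrakk>f \<in> Hom M X X'; g \<in> Hom M Y Y'\<rbrakk> \<Longrightarrow>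
          Sym M X' Y' \<cdot> tenA M f g = tenA M g f \<cdot> Sym M X Y"
    and pentagon: "\<lbrakk>W \<in> Ob M; X \<in> Ob M; Y \<in> Ob M; Z \<in> Ob M\<rbrakk> \<Longrightarrow>
          Asc M W X (tenO M Y Z) \<cdot> Asc M (tenO M W X) Y Z =
          tenA M (Id M W) (Asc M X Y Z) \<cdot> Asc M W (tenO M X Y) Z \<cdot> tenA M (Asc M W X Y) (Id M Z)"
    and triangle: "\<lbrakk>X \<in> Ob M; Y \<in> Ob M\<rbrakk> \<Longrightarrow>
          tenA M (Id M X) (LUn M Y) \<cdot> Asc M X (Unt M) Y = tenA M (RUn M X) (Id M Y)"
    and hexagon: "\<lbrakk>X \<in> Ob M; Y \<in> Ob M; Z \<in> Ob M\<rbrakk> \<Longrightarrow>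
          Asc M Y Z X \<cdot> Sym M X (tenO M Y Z) \<cdot> Asc M X Y Z =
          tenA M (Id M Y) (Sym M X Z) \<cdot> Asc M Y X Z \<cdot> tenA M (Sym M X Y) (Id M Z)"
    and Sym_Sym: "\<lbrakk>X \<in> Ob M; Y \<in> Ob M\<rbrakk> \<Longrightarrow> Sym M Y X \<cdot> Sym M X Y = Id M (tenO M X Y)"

locale symmetric_2group = symmetric_monoidal_category M
  for M :: "('o, 'a, 'z) sm_cat_scheme" (structure) +
  assumes all_iso: "f \<in> Ar M \<Longrightarrow> is_iso M f"
    and weakly_invertible: "X \<in> Ob M \<Longrightarrow>
          \<exists>Y \<in> Ob M. isomorphic M (tenO M X Y) (Unt M) \<and> isomorphic M (tenO M Y X) (Unt M)"

text \<open>\<open>Mul X Y : F X \<otimes> F Y \<rightarrow> F (X \<otimes> Y)\<close> and \<open>Mun : I \<rightarrow> F I\<close>.\<close>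

record ('o, 'a, 'p, 'b) sm_functor_data = "('o, 'a, 'p, 'b) functor_data" +
  Mul :: "'o \<Rightarrow> 'o \<Rightarrow> 'b"
  Mun :: "'b"

definition symmetric_monoidal_functor ::
  "('o, 'a, 'z) sm_cat_scheme \<Rightarrow> ('p, 'b, 'y) sm_cat_scheme
     \<Rightarrow> ('o, 'a, 'p, 'b, 'x) sm_functor_data_scheme \<Rightarrow> bool" where
  "symmetric_monoidal_functor M N F \<longleftrightarrow>
     is_functor M N F \<and>
     (\<forall>X \<in> Ob M. \<forall>Y \<in> Ob M.
        Mul F X Y \<in> Hom N (tenO N (FO F X) (FO F Y)) (FO F (tenO M X Y)) \<and> is_iso N (Mul F X Y)) \<and>
     Mun F \<in> Hom N (Unt N) (FO F (Unt M)) \<and> is_iso N (Mun F) \<and>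
     (\<forall>f \<in> Ar M. \<forall>g \<in> Ar M.
        Mul F (Cod M f) (Cod M g) \<cdot>\<^bsub>N\<^esub> tenA N (FA F f) (FA F g) =
        FA F (tenA M f g) \<cdot>\<^bsub>N\<^esub> Mul F (Dom M f) (Dom M g)) \<and>
     (\<forall>X \<in> Ob M. \<forall>Y \<in> Ob M. \<forall>Z \<in> Ob M.
        FA F (Asc M X Y Z) \<cdot>\<^bsub>N\<^esub> Mul F (tenO M X Y) Z \<cdot>\<^bsub>N\<^esub> tenA N (Mul F X Y) (Id N (FO F Z)) =
        Mul F X (tenO M Y Z) \<cdot>\<^bsub>N\<^esub> tenA N (Id N (FO F X)) (Mul F Y Z)
          \<cdot>\<^bsub>N\<^esub> Asc N (FO F X) (FO F Y) (FO F Z)) \<and>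
     (\<forall>X \<in> Ob M.
        FA F (LUn M X) \<cdot>\<^bsub>N\<^esub> Mul F (Unt M) X \<cdot>\<^bsub>N\<^esub> tenA N (Mun F) (Id N (FO F X)) = LUn N (FO F X)) \<and>
     (\<forall>X \<in> Ob M.
        FA F (RUn M X) \<cdot>\<^bsub>N\<^esub> Mul F X (Unt M) \<cdot>\<^bsub>N\<^esub> tenA N (Id N (FO F X)) (Mun F) = RUn N (FO F X)) \<and>
     (\<forall>X \<in> Ob M. \<forall>Y \<in> Ob M.
        FA F (Sym M X Y) \<cdot>\<^bsub>N\<^esub> Mul F X Y = Mul F Y X \<cdot>\<^bsub>N\<^esub> Sym N (FO F X) (FO F Y))"

definition id_sm_functor :: "('o, 'a, 'z) sm_cat_scheme \<Rightarrow> ('o, 'a, 'o, 'a) sm_functor_data" where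
  "id_sm_functor M =
     \<lparr>FO = \<lambda>X. X, FA = \<lambda>f. f, Mul = \<lambda>X Y. Id M (tenO M X Y), Mun = Id M (Unt M)\<rparr>"

text \<open>\<open>N\<close> is the codomain of \<open>G\<close>, in which the structure arrows are composed.\<close>

definition comp_sm_functor ::
  "('q, 'c, 'z) sm_cat_scheme \<Rightarrow> ('p, 'b, 'q, 'c) sm_functor_data \<Rightarrow> ('o, 'a, 'p, 'b) sm_functor_data
     \<Rightarrow> ('o, 'a, 'q, 'c) sm_functor_data" where
  "comp_sm_functor N G F =
     \<lparr>FO = \<lambda>X. FO G (FO F X), FA = \<lambda>f. FA G (FA F f),
      Mul = \<lambda>X Y. FA G (Mul F X Y) \<cdot>\<^bsub>N\<^esub> Mul G (FO F X) (FO F Y),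
      Mun = FA G (Mun F) \<cdot>\<^bsub>N\<^esub> Mun G\<rparr>"

definition monoidal_nat_trans ::
  "('o, 'a, 'z) sm_cat_scheme \<Rightarrow> ('p, 'b, 'y) sm_cat_scheme
     \<Rightarrow> ('o, 'a, 'p, 'b, 'x) sm_functor_data_scheme \<Rightarrow> ('o, 'a, 'p, 'b, 'w) sm_functor_data_scheme
     \<Rightarrow> ('o \<Rightarrow> 'b) \<Rightarrow> bool" where
  "monoidal_nat_trans M N F G t \<longleftrightarrow>
     nat_trans M N F G t \<and>
     (\<forall>X \<in> Ob M. \<forall>Y \<in> Ob M. t (tenO M X Y) \<cdot>\<^bsub>N\<^esub> Mul F X Y = Mul G X Y \<cdot>\<^bsub>N\<^esub> tenA N (t X) (t Y)) \<and>
     t (Unt M) \<cdot>\<^bsub>N\<^esub> Mun F = Mun G"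


section \<open>Pseudofunctors into Cat and into the 2-category of symmetric 2-groups\<close>

text \<open>\<open>PComp g f : PArr g \<circ> PArr f \<Rightarrow> PArr (g \<cdot> f)\<close> and \<open>PUnit A : 1 \<Rightarrow> PArr (Id A)\<close>.\<close>

record ('p, 'b, 'o, 'a) cat_psf =
  PObj :: "'p \<Rightarrow> ('o, 'a) cat"
  PArr :: "'b \<Rightarrow> ('o, 'a, 'o, 'a) functor_data"
  PComp :: "'b \<Rightarrow> 'b \<Rightarrow> 'o \<Rightarrow> 'a"
  PUnit :: "'p \<Rightarrow> 'o \<Rightarrow> 'a"

locale pseudofunctor_to_Cat = category B
  for B :: "('p, 'b, 'z) cat_scheme" (structure) +
  fixes F :: "('p, 'b, 'o, 'a) cat_psf"
  assumes PObj_category: "A \<in> Ob B \<Longrightarrow> category (PObj F A)"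
    and PArr_functor: "f \<in> Hom B A A' \<Longrightarrow> is_functor (PObj F A) (PObj F A') (PArr F f)"
    and PComp_nat_iso: "\<lbrakk>f \<in> Hom B A A'; g \<in> Hom B A' A''\<rbrakk> \<Longrightarrow>
          nat_iso (PObj F A) (PObj F A'') (comp_functor (PArr F g) (PArr F f)) (PArr F (g \<cdot> f)) (PComp F g f)"
    and PUnit_nat_iso: "A \<in> Ob B \<Longrightarrow>
          nat_iso (PObj F A) (PObj F A) id_functor (PArr F (Id B A)) (PUnit F A)"
    and PComp_assoc: "\<lbrakk>f \<in> Hom B A A'; g \<in> Hom B A' A''; h \<in> Hom B A'' A'''; X \<in> Ob (PObj F A)\<rbrakk> \<Longrightarrow>
          PComp F h (g \<cdot> f) X \<cdot>\<^bsub>PObj F A'''\<^esub> FA (PArr F h) (PComp F g f X) =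
          PComp F (h \<cdot> g) f X \<cdot>\<^bsub>PObj F A'''\<^esub> PComp F h g (FO (PArr F f) X)"
    and PComp_PUnit_right: "\<lbrakk>f \<in> Hom B A A'; X \<in> Ob (PObj F A)\<rbrakk> \<Longrightarrow>
          PComp F f (Id B A) X \<cdot>\<^bsub>PObj F A'\<^esub> FA (PArr F f) (PUnit F A X) = Id (PObj F A') (FO (PArr F f) X)"
    and PComp_PUnit_left: "\<lbrakk>f \<in> Hom B A A'; X \<in> Ob (PObj F A)\<rbrakk> \<Longrightarrow>
          PComp F (Id B A') f X \<cdot>\<^bsub>PObj F A'\<^esub> PUnit F A' (FO (PArr F f) X) =
          Id (PObj F A') (FO (PArr F f) X)"

record ('p, 'b, 'o, 'a) sym2gp_psf =
  SObj :: "'p \<Rightarrow> ('o, 'a) sm_cat"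
  SArr :: "'b \<Rightarrow> ('o, 'a, 'o, 'a) sm_functor_data"
  SComp :: "'b \<Rightarrow> 'b \<Rightarrow> 'o \<Rightarrow> 'a"
  SUnit :: "'p \<Rightarrow> 'o \<Rightarrow> 'a"

text \<open>Composition with the forgetful 2-functor to Cat.\<close>

definition forget_sym2gp :: "('p, 'b, 'o, 'a) sym2gp_psf \<Rightarrow> ('p, 'b, 'o, 'a) cat_psf" where
  "forget_sym2gp G =
     \<lparr>PObj = \<lambda>A. cat.truncate (SObj G A), PArr = \<lambda>f. functor_data.truncate (SArr G f),
      PComp = SComp G, PUnit = SUnit G\<rparr>"

text \<open>The 1-cells between symmetric 2-groups are the symmetric monoidal functors and the 2-cells the
  monoidal transformations. Since 2-cells are determined by, and composed and whiskered through, their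
  underlying natural transformations, the coherence equations of a pseudofunctor (and the invertibility
  of its comparison 2-cells) are those of the underlying pseudofunctor into Cat.\<close>

locale pseudofunctor_to_Sym2Gp =
  fixes B :: "('p, 'b, 'z) cat_scheme" (structure) and G :: "('p, 'b, 'o, 'a) sym2gp_psf"
  assumes underlying: "pseudofunctor_to_Cat B (forget_sym2gp G)"
    and SObj_symmetric_2group: "A \<in> Ob B \<Longrightarrow> symmetric_2group (SObj G A)"
    and SArr_symmetric_monoidal:
          "f \<in> Hom B A A' \<Longrightarrow> symmetric_monoidal_functor (SObj G A) (SObj G A') (SArr G f)"
    and SComp_monoidal: "\<lbrakk>f \<in> Hom B A A'; g \<in> Hom B A' A''\<rbrakk> \<Longrightarrow>
          monoidal_nat_trans (SObj G A) (SObj G A'')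
            (comp_sm_functor (SObj G A'') (SArr G g) (SArr G f)) (SArr G (g \<cdot> f)) (SComp G g f)"
    and SUnit_monoidal: "A \<in> Ob B \<Longrightarrow>
          monoidal_nat_trans (SObj G A) (SObj G A) (id_sm_functor (SObj G A)) (SArr G (Id B A)) (SUnit G A)"


section \<open>Cartesian monoidal opfibrations\<close>

text \<open>\<open>lift P f X\<close> is the chosen cocartesian arrow over \<open>f\<close> with domain \<open>X\<close>.\<close>

record ('o, 'a, 'p, 'b) opfib =
  total :: "('o, 'a) fp_cat"
  base :: "('p, 'b) fp_cat"
  proj :: "('o, 'a, 'p, 'b) functor_data"
  lift :: "'b \<Rightarrow> 'o \<Rightarrow> 'a"

abbreviation projO :: "('o, 'a, 'p, 'b) opfib \<Rightarrow> 'o \<Rightarrow> 'p" where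
  "projO P \<equiv> FO (proj P)"

abbreviation projA :: "('o, 'a, 'p, 'b) opfib \<Rightarrow> 'a \<Rightarrow> 'b" where
  "projA P \<equiv> FA (proj P)"

definition cocartesian :: "('o, 'a, 'p, 'b) opfib \<Rightarrow> 'a \<Rightarrow> bool" where
  "cocartesian P u \<longleftrightarrow> u \<in> Ar (total P) \<and>
     (\<forall>h \<in> Ar (total P). \<forall>w \<in> Hom (base P) (projO P (Cod (total P) u)) (projO P (Cod (total P) h)).
        Dom (total P) h = Dom (total P) u \<and> w \<cdot>\<^bsub>base P\<^esub> projA P u = projA P h \<longrightarrow>
        (\<exists>!v. v \<in> Hom (total P) (Cod (total P) u) (Cod (total P) h) \<and> projA P v = w \<and>
              v \<cdot>\<^bsub>total P\<^esub> u = h))"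

locale cloven_opfibration =
  fixes P :: "('o, 'a, 'p, 'b) opfib"
  assumes total_category: "category (total P)"
    and base_category: "category (base P)"
    and proj_functor: "is_functor (total P) (base P) (proj P)"
    and lift: "\<lbrakk>f \<in> Ar (base P); X \<in> Ob (total P); projO P X = Dom (base P) f\<rbrakk> \<Longrightarrow>
          cocartesian P (lift P f X) \<and> Dom (total P) (lift P f X) = X \<and> projA P (lift P f X) = f"

locale cartesian_monoidal_opfibration = cloven_opfibration P
  for P :: "('o, 'a, 'p, 'b) opfib" +
  assumes total_products: "finite_product_category (total P)"
    and base_products: "finite_product_category (base P)"
    and proj_One: "projO P (One (total P)) = One (base P)"
    and proj_Prd: "\<lbrakk>X \<in> Ob (total P); Y \<in> Ob (total P)\<rbrakk> \<Longrightarrow>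
          projO P (Prd (total P) X Y) = Prd (base P) (projO P X) (projO P Y)"
    and proj_pr1: "\<lbrakk>X \<in> Ob (total P); Y \<in> Ob (total P)\<rbrakk> \<Longrightarrow>
          projA P (pr1 (total P) X Y) = pr1 (base P) (projO P X) (projO P Y)"
    and proj_pr2: "\<lbrakk>X \<in> Ob (total P); Y \<in> Ob (total P)\<rbrakk> \<Longrightarrow>
          projA P (pr2 (total P) X Y) = pr2 (base P) (projO P X) (projO P Y)"
    and cocartesian_prod: "\<lbrakk>cocartesian P u; cocartesian P v\<rbrakk> \<Longrightarrow> cocartesian P (prod_arr (total P) u v)"

definition fibre :: "('o, 'a, 'p, 'b) opfib \<Rightarrow> 'p \<Rightarrow> ('o, 'a) cat" where
  "fibre P A =
     \<lparr>Ob = {X \<in> Ob (total P). projO P X = A},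
      Ar = {v \<in> Ar (total P). projO P (Dom (total P) v) = A \<and> projO P (Cod (total P) v) = A \<and>
                              projA P v = Id (base P) A},
      Dom = Dom (total P), Cod = Cod (total P), Id = Id (total P), Comp = Comp (total P)\<rparr>"

text \<open>The arrow over \<open>w\<close> induced by \<open>h\<close> through the cocartesian arrow \<open>u\<close>; vertical if \<open>w\<close> is an identity.\<close>

definition induced :: "('o, 'a, 'p, 'b) opfib \<Rightarrow> 'a \<Rightarrow> 'a \<Rightarrow> 'b \<Rightarrow> 'a" where
  "induced P u h w =
     (THE v. v \<in> Hom (total P) (Cod (total P) u) (Cod (total P) h) \<and> projA P v = w \<and> v \<cdot>\<^bsub>total P\<^esub> u = h)"

definition change_of_base :: "('o, 'a, 'p, 'b) opfib \<Rightarrow> 'b \<Rightarrow> ('o, 'a, 'o, 'a) functor_data" where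
  "change_of_base P f =
     \<lparr>FO = \<lambda>X. Cod (total P) (lift P f X),
      FA = \<lambda>v. induced P (lift P f (Dom (total P) v)) (lift P f (Cod (total P) v) \<cdot>\<^bsub>total P\<^esub> v)
                 (Id (base P) (Cod (base P) f))\<rparr>"

definition associated_pseudofunctor :: "('o, 'a, 'p, 'b) opfib \<Rightarrow> ('p, 'b, 'o, 'a) cat_psf" where
  "associated_pseudofunctor P =
     \<lparr>PObj = fibre P,
      PArr = change_of_base P,
      PComp = \<lambda>g f X. induced P
        (lift P g (FO (change_of_base P f) X) \<cdot>\<^bsub>total P\<^esub> lift P f X)
        (lift P (g \<cdot>\<^bsub>base P\<^esub> f) X)
        (Id (base P) (Cod (base P) g)),
      PUnit = \<lambda>A X. lift P (Id (base P) A) X\<rparr>"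


section \<open>The symmetric monoidal structure on the fibres\<close>

text \<open>The lax structure \<open>R\<^sup>A\<^sup>,\<^sup>B : F A \<times> F B \<rightarrow> F (A \<times> B)\<close> of \<open>F\<close>; the data do not mention \<open>A\<close> and \<open>B\<close>.\<close>

definition lax_prod :: "('o, 'a, 'p, 'b) opfib \<Rightarrow> ('o \<times> 'o, 'a \<times> 'a, 'o, 'a) functor_data" where
  "lax_prod P = \<lparr>FO = \<lambda>(X, Y). Prd (total P) X Y, FA = \<lambda>(f, g). prod_arr (total P) f g\<rparr>"

definition fibre_ten :: "('o, 'a, 'p, 'b) opfib \<Rightarrow> 'p \<Rightarrow> ('o \<times> 'o, 'a \<times> 'a, 'o, 'a) functor_data" where
  "fibre_ten P A = comp_functor (change_of_base P (add_mult (base P) A)) (lax_prod P)"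

definition fibre_unit :: "('o, 'a, 'p, 'b) opfib \<Rightarrow> 'p \<Rightarrow> 'o" where
  "fibre_unit P A = FO (change_of_base P (add_unit (base P) A)) (One (total P))"

text \<open>The chosen cocartesian arrows \<open>X \<times> Y \<rightarrow> X \<otimes> Y\<close> over \<open>m\<close> and \<open>I \<rightarrow> e\<^sub>* I\<close> over \<open>e\<close>. The coherence
  isomorphisms of the tensor product are the vertical arrows induced along them by the coherence
  isomorphisms of the cartesian product in the total category, i.e. the composites of the comparison
  isomorphisms of \<open>F\<close> and \<open>R\<close> over the commutative monoid equations for \<open>m\<close> and \<open>e\<close>.\<close>

definition ten_lift :: "('o, 'a, 'p, 'b) opfib \<Rightarrow> 'p \<Rightarrow> 'o \<Rightarrow> 'o \<Rightarrow> 'a" where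
  "ten_lift P A X Y = lift P (add_mult (base P) A) (Prd (total P) X Y)"

definition unit_lift :: "('o, 'a, 'p, 'b) opfib \<Rightarrow> 'p \<Rightarrow> 'a" where
  "unit_lift P A = lift P (add_unit (base P) A) (One (total P))"

definition fibre_assoc :: "('o, 'a, 'p, 'b) opfib \<Rightarrow> 'p \<Rightarrow> 'o \<Rightarrow> 'o \<Rightarrow> 'o \<Rightarrow> 'a" where
  "fibre_assoc P A X Y Z = induced P
     (ten_lift P A (FO (fibre_ten P A) (X, Y)) Z
        \<cdot>\<^bsub>total P\<^esub> prod_arr (total P) (ten_lift P A X Y) (Id (total P) Z))
     (ten_lift P A X (FO (fibre_ten P A) (Y, Z))
        \<cdot>\<^bsub>total P\<^esub> prod_arr (total P) (Id (total P) X) (ten_lift P A Y Z)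
        \<cdot>\<^bsub>total P\<^esub> prod_assoc (total P) X Y Z)
     (Id (base P) A)"

definition fibre_lunit :: "('o, 'a, 'p, 'b) opfib \<Rightarrow> 'p \<Rightarrow> 'o \<Rightarrow> 'a" where
  "fibre_lunit P A X = induced P
     (ten_lift P A (fibre_unit P A) X \<cdot>\<^bsub>total P\<^esub> prod_arr (total P) (unit_lift P A) (Id (total P) X))
     (pr2 (total P) (One (total P)) X)
     (Id (base P) A)"

definition fibre_runit :: "('o, 'a, 'p, 'b) opfib \<Rightarrow> 'p \<Rightarrow> 'o \<Rightarrow> 'a" where
  "fibre_runit P A X = induced P
     (ten_lift P A X (fibre_unit P A) \<cdot>\<^bsub>total P\<^esub> prod_arr (total P) (Id (total P) X) (unit_lift P A))
     (pr1 (total P) X (One (total P)))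
     (Id (base P) A)"

definition fibre_sym :: "('o, 'a, 'p, 'b) opfib \<Rightarrow> 'p \<Rightarrow> 'o \<Rightarrow> 'o \<Rightarrow> 'a" where
  "fibre_sym P A X Y = induced P
     (ten_lift P A X Y)
     (ten_lift P A Y X \<cdot>\<^bsub>total P\<^esub> prod_swap (total P) X Y)
     (Id (base P) A)"

definition fibre_sm :: "('o, 'a, 'p, 'b) opfib \<Rightarrow> 'p \<Rightarrow> ('o, 'a) sm_cat" where
  "fibre_sm P A = cat.extend (fibre P A)
     (sm_cat.fields (fibre_ten P A) (fibre_unit P A) (fibre_assoc P A)
        (fibre_lunit P A) (fibre_runit P A) (fibre_sym P A))"

definition factors_through_Sym2Gp :: "('o, 'a, 'p, 'b) opfib \<Rightarrow> bool" where
  "factors_through_Sym2Gp P \<longleftrightarrow>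
     (\<exists>G. pseudofunctor_to_Sym2Gp (base P) G \<and>
          forget_sym2gp G = associated_pseudofunctor P \<and>
          (\<forall>A \<in> Ob (base P). SObj G A = fibre_sm P A))"

end

theory Submission
  imports Defs
begin

text \<open>In an additive category the internal abelian group on \<open>A\<close> is given by \<open>pr1 + pr2\<close> and \<open>0\<close>, so that an arrow
  into \<open>A \<times> A\<close> followed by the multiplication is the sum of its components and every arrow is a
  homomorphism. Upstairs, arrows \<open>a : Z \<rightarrow> X\<close> and \<open>b : Z \<rightarrow> Y\<close> over \<open>\<alpha>, \<beta> : C \<rightarrow> A\<close> have a product
  \<open>a \<cdot> b : Z \<rightarrow> X \<otimes> Y\<close> over \<open>\<alpha> + \<beta>\<close>, and every structure arrow is characterised by its effect on such
  generalised elements: the associator sends \<open>(a \<cdot> b) \<cdot> c\<close> to \<open>a \<cdot> (b \<cdot> c)\<close>, the symmetry sends \<open>a \<cdot> b\<close>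
  to \<open>b \<cdot> a\<close>, and so on. Since the products of projections are cocartesian, two vertical arrows that agree
  on them are equal, which turns every coherence axiom into an identity between words.

  Vertical arrows are invertible by a Mal'cev argument. Let \<open>k (a, b, c) = a - b + c\<close>. For \<open>X, Y\<close> over \<open>A\<close>
  the arrow \<open>1 \<times> \<Delta> : X \<times> Y \<rightarrow> X \<times> (Y \<times> Y)\<close> is cocartesian, hence there is \<open>g : X \<times> (Y \<times> Y) \<rightarrow> X\<close> over \<open>k\<close>
  with \<open>g (a, b, b) = a\<close>. The second projection \<open>X \<times> Y \<rightarrow> Y\<close> is cocartesian because terminal maps are, and the
  inverse \<open>w\<close> of a vertical \<open>v : X \<rightarrow> Y\<close> is determined by \<open>w b = g (a, v a, b)\<close>. Finally, a weak inverse of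
  \<open>X\<close> is its pushforward along \<open>-1\<close>: the arrow \<open>x \<mapsto> x \<cdot> (-x)\<close> is cocartesian over \<open>0\<close>.\<close>

section \<open>Categories with finite products\<close>

context category
begin

lemma Comp_typing [simp]:
  assumes "f \<in> Ar C" "g \<in> Ar C" "Cod C f = Dom C g"
  shows "g \<cdot> f \<in> Ar C" "Dom C (g \<cdot> f) = Dom C f" "Cod C (g \<cdot> f) = Cod C g"
  using Comp_in_Hom[of f "Dom C f" "Dom C g" g "Cod C g"] assms by (auto simp: Hom_def)

lemma Id_typing [simp]:
  assumes "A \<in> Ob C"
  shows "Id C A \<in> Ar C" "Dom C (Id C A) = A" "Cod C (Id C A) = A"
  using Id_in_Hom[OF assms] by (auto simp: Hom_def)

lemma Dom_Cod_Ob [simp]: "f \<in> Ar C \<Longrightarrow> Dom C f \<in> Ob C" "f \<in> Ar C \<Longrightarrow> Cod C f \<in> Ob C"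
  by (auto intro: Dom_in_Ob Cod_in_Ob)

text \<open>The object \<open>A\<close> is a separate variable tied to the arrow by a side
  condition, so that rewriting also applies when \<open>A\<close> is only provably the
  domain.\<close>

lemma Comp_Id_right [simp]: "f \<in> Ar C \<Longrightarrow> Dom C f = A \<Longrightarrow> f \<cdot> Id C A = f"
  using Comp_Id by blast

lemma Id_Comp_left [simp]: "f \<in> Ar C \<Longrightarrow> Cod C f = A \<Longrightarrow> Id C A \<cdot> f = f"
  using Id_Comp by blast

lemma Comp_assoc_Ar [simp]:
  assumes "f \<in> Ar C" "g \<in> Ar C" "h \<in> Ar C" "Cod C f = Dom C g" "Cod C g = Dom C h"
  shows "(h \<cdot> g) \<cdot> f = h \<cdot> (g \<cdot> f)"
  using Comp_assoc[of f "Dom C f" "Dom C g" g "Dom C h" h "Cod C h"] assms by (auto simp: Hom_def)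

end

section \<open>Terminal maps and pairings as a rewrite system\<close>

context finite_product_category
begin

lemma One_Ob [simp]: "One C \<in> Ob C"
  by (rule One_in_Ob)

lemma Prd_Ob [simp]: "A \<in> Ob C \<Longrightarrow> B \<in> Ob C \<Longrightarrow> Prd C A B \<in> Ob C"
  by (rule Prd_in_Ob)

lemma pr_typing [simp]:
  assumes "A \<in> Ob C" "B \<in> Ob C"
  shows "pr1 C A B \<in> Ar C" "Dom C (pr1 C A B) = Prd C A B" "Cod C (pr1 C A B) = A"
    "pr2 C A B \<in> Ar C" "Dom C (pr2 C A B) = Prd C A B" "Cod C (pr2 C A B) = B"
  using pr1_in_Hom[OF assms] pr2_in_Hom[OF assms] by (auto simp: Hom_def)

lemma terminal_typing [simp]:
  assumes "A \<in> Ob C"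
  shows "terminal_map C A \<in> Ar C" "Dom C (terminal_map C A) = A" "Cod C (terminal_map C A) = One C"
  using theI'[OF One_terminal[OF assms]] unfolding terminal_map_def[symmetric] by (auto simp: Hom_def)

lemma terminal_unique:
  assumes "f \<in> Ar C" "Cod C f = One C"
  shows "f = terminal_map C (Dom C f)"
proof -
  have "f \<in> Hom C (Dom C f) (One C)" "terminal_map C (Dom C f) \<in> Hom C (Dom C f) (One C)"
    using assms by (auto simp: Hom_def)
  then show ?thesis
    using One_terminal[OF Dom_in_Ob[OF assms(1)]] by metis
qed

lemma terminal_Comp [simp]:
  assumes "f \<in> Ar C" "Cod C f = A"
  shows "terminal_map C A \<cdot> f = terminal_map C (Dom C f)"
  using terminal_unique[of "terminal_map C A \<cdot> f"] assms by auto

lemma pair_props: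
  assumes "f \<in> Ar C" "g \<in> Ar C" "Dom C f = Dom C g"
  shows "pair_arr C f g \<in> Hom C (Dom C f) (Prd C (Cod C f) (Cod C g)) \<and>
    pr1 C (Cod C f) (Cod C g) \<cdot> pair_arr C f g = f \<and> pr2 C (Cod C f) (Cod C g) \<cdot> pair_arr C f g = g"
proof -
  have "f \<in> Hom C (Dom C f) (Cod C f)" "g \<in> Hom C (Dom C f) (Cod C g)"
    using assms by (auto simp: Hom_def)
  from theI'[OF Prd_universal[OF this]] show ?thesis
    unfolding pair_arr_def .
qed

lemma pair_typing [simp]:
  assumes "f \<in> Ar C" "g \<in> Ar C" "Dom C f = Dom C g"
  shows "pair_arr C f g \<in> Ar C" "Dom C (pair_arr C f g) = Dom C g"
    "Cod C (pair_arr C f g) = Prd C (Cod C f) (Cod C g)"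
  using pair_props[OF assms] assms(3) by (auto simp: Hom_def)

lemma pr_pair [simp]:
  assumes "f \<in> Ar C" "g \<in> Ar C" "Dom C f = Dom C g" "Cod C f = A" "Cod C g = B"
  shows "pr1 C A B \<cdot> pair_arr C f g = f" "pr2 C A B \<cdot> pair_arr C f g = g"
  using pair_props[OF assms(1-3)] assms(4,5) by auto

lemma pair_unique:
  assumes "h \<in> Ar C" "h' \<in> Ar C" "Dom C h = Dom C h'" "Cod C h = Prd C A B" "Cod C h' = Prd C A B"
    "A \<in> Ob C" "B \<in> Ob C"
    "pr1 C A B \<cdot> h = pr1 C A B \<cdot> h'" "pr2 C A B \<cdot> h = pr2 C A B \<cdot> h'"
  shows "h = h'"
proof -
  have "pr1 C A B \<cdot> h \<in> Hom C (Dom C h) A" "pr2 C A B \<cdot> h \<in> Hom C (Dom C h) B"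
    "h \<in> Hom C (Dom C h) (Prd C A B)" "h' \<in> Hom C (Dom C h) (Prd C A B)"
    using assms by (auto simp: Hom_def)
  with Prd_universal[OF this(1,2)] assms(8,9) show ?thesis
    by metis
qed

text \<open>Together with the projection rules this normalises maps between products to tuples of
  words in generalised elements.\<close>

lemma pair_Comp [simp]:
  assumes "f \<in> Ar C" "g \<in> Ar C" "Dom C f = Dom C g" "h \<in> Ar C" "Cod C h = Dom C g"
  shows "pair_arr C f g \<cdot> h = pair_arr C (f \<cdot> h) (g \<cdot> h)"
proof (rule pair_unique[where A = "Cod C f" and B = "Cod C g"])
  show "pr1 C (Cod C f) (Cod C g) \<cdot> (pair_arr C f g \<cdot> h) =
      pr1 C (Cod C f) (Cod C g) \<cdot> pair_arr C (f \<cdot> h) (g \<cdot> h)"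
    using assms by (simp add: Comp_assoc_Ar[symmetric] del: Comp_assoc_Ar)
  show "pr2 C (Cod C f) (Cod C g) \<cdot> (pair_arr C f g \<cdot> h) =
      pr2 C (Cod C f) (Cod C g) \<cdot> pair_arr C (f \<cdot> h) (g \<cdot> h)"
    using assms by (simp add: Comp_assoc_Ar[symmetric] del: Comp_assoc_Ar)
qed (use assms in auto)

lemma pair_eta:
  assumes "A \<in> Ob C" "B \<in> Ob C"
  shows "pair_arr C (pr1 C A B) (pr2 C A B) = Id C (Prd C A B)"
  by (rule pair_unique[where A = A and B = B]) (use assms in auto)

lemma pair_eta_Comp [simp]:
  assumes "A \<in> Ob C" "B \<in> Ob C" "h \<in> Ar C" "Cod C h = Prd C A B"
  shows "pair_arr C (pr1 C A B \<cdot> h) (pr2 C A B \<cdot> h) = h"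
  by (rule pair_unique[where A = A and B = B]) (use assms in auto)

lemma prod_arr_eq [simp]:
  assumes "f \<in> Ar C" "g \<in> Ar C" "Dom C f = A" "Dom C g = B"
  shows "prod_arr C f g = pair_arr C (f \<cdot> pr1 C A B) (g \<cdot> pr2 C A B)"
  using assms by (simp add: prod_arr_def)

lemma diagonal_eq [simp]: "diagonal_map C A = pair_arr C (Id C A) (Id C A)"
  by (simp add: diagonal_map_def)

lemma prod_swap_eq [simp]: "prod_swap C A B = pair_arr C (pr2 C A B) (pr1 C A B)"
  by (simp add: prod_swap_def)

text \<open>Addition of generalised elements of \<open>A\<close> at a common stage, expressed
  through the internal multiplication.\<close>

definition add_arr :: "'o \<Rightarrow> 'a \<Rightarrow> 'a \<Rightarrow> 'a" where
  "add_arr A f g = add_mult C A \<cdot> pair_arr C f g"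

end

section \<open>Internal abelian groups in preadditive categories\<close>

locale preadditive_fp_category = finite_product_category C
  for C :: "('o, 'a, 'z) fp_cat_scheme" (structure) +
  fixes ab :: "'o \<Rightarrow> 'o \<Rightarrow> 'a monoid"
  assumes preadditive: "preadditive_structure C ab"
begin

section \<open>Bilinear addition of arrows\<close>

definition plus :: "'a \<Rightarrow> 'a \<Rightarrow> 'a" (infixl "\<^bold>+" 65) where
  "f \<^bold>+ g = f \<otimes>\<^bsub>ab (Dom C f) (Cod C f)\<^esub> g"

definition zero :: "'o \<Rightarrow> 'o \<Rightarrow> 'a" where
  "zero A B = \<one>\<^bsub>ab A B\<^esub>"

definition neg :: "'o \<Rightarrow> 'a" where
  "neg A = inv\<^bsub>ab A A\<^esub> (Id C A)"

lemma ab_group: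
  assumes "A \<in> Ob C" "B \<in> Ob C"
  shows "comm_group (ab A B)" "carrier (ab A B) = Hom C A B"
  using preadditive assms by (auto simp: preadditive_structure_def)

lemma plus_typing [simp]:
  assumes "f \<in> Ar C" "g \<in> Ar C" "Dom C f = Dom C g" "Cod C f = Cod C g"
  shows "f \<^bold>+ g \<in> Ar C" "Dom C (f \<^bold>+ g) = Dom C g" "Cod C (f \<^bold>+ g) = Cod C g"
proof -
  interpret comm_group "ab (Dom C f) (Cod C f)" using assms by (simp add: ab_group)
  have "f \<^bold>+ g \<in> carrier (ab (Dom C f) (Cod C f))"
    unfolding plus_def using assms by (intro m_closed) (auto simp: ab_group Hom_def)
  with assms show "f \<^bold>+ g \<in> Ar C" "Dom C (f \<^bold>+ g) = Dom C g" "Cod C (f \<^bold>+ g) = Cod C g"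
    by (auto simp: ab_group Hom_def)
qed

lemma plus_Comp [simp]:
  assumes "f \<in> Ar C" "g \<in> Ar C" "Dom C f = Dom C g" "Cod C f = Cod C g" "h \<in> Ar C" "Cod C h = Dom C g"
  shows "(f \<^bold>+ g) \<cdot> h = f \<cdot> h \<^bold>+ g \<cdot> h"
  using preadditive assms unfolding preadditive_structure_def plus_def
  by (auto simp: Hom_def)

lemma Comp_plus [simp]:
  assumes "f \<in> Ar C" "g \<in> Ar C" "Dom C f = Dom C g" "Cod C f = Cod C g" "h \<in> Ar C" "Dom C h = Cod C g"
  shows "h \<cdot> (f \<^bold>+ g) = h \<cdot> f \<^bold>+ h \<cdot> g"
  using preadditive assms unfolding preadditive_structure_def plus_def
  by (auto simp: Hom_def)

lemma zero_typing [simp]: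
  assumes "A \<in> Ob C" "B \<in> Ob C"
  shows "zero A B \<in> Ar C" "Dom C (zero A B) = A" "Cod C (zero A B) = B"
proof -
  interpret comm_group "ab A B" using assms by (simp add: ab_group)
  show "zero A B \<in> Ar C" "Dom C (zero A B) = A" "Cod C (zero A B) = B"
    using one_closed assms by (auto simp: zero_def ab_group Hom_def)
qed

text \<open>The unit is the only idempotent of a group. This is how composites with zero are
  recognised as zero.\<close>

lemma plus_idem_zero:
  assumes "f \<in> Ar C" "f \<^bold>+ f = f"
  shows "f = zero (Dom C f) (Cod C f)"
proof -
  interpret comm_group "ab (Dom C f) (Cod C f)" using assms by (simp add: ab_group)
  have "f \<in> carrier (ab (Dom C f) (Cod C f))" using assms(1) by (simp add: ab_group Hom_def)
  then show ?thesis using assms(2) unfolding zero_def plus_def by (metis l_cancel_one')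
qed

lemma plus_zero [simp]:
  assumes "f \<in> Ar C" "Dom C f = A" "Cod C f = B"
  shows "zero A B \<^bold>+ f = f" "f \<^bold>+ zero A B = f"
proof -
  interpret comm_group "ab A B" using assms by (auto simp: ab_group)
  have c: "f \<in> carrier (ab A B)" using assms by (auto simp: ab_group Hom_def)
  have "A \<in> Ob C" "B \<in> Ob C" using assms by auto
  from zero_typing[OF this] show "zero A B \<^bold>+ f = f" "f \<^bold>+ zero A B = f"
    using l_one[OF c] r_one[OF c] assms by (simp_all add: plus_def zero_def)
qed

lemma plus_assoc:
  assumes "f \<in> Ar C" "g \<in> Ar C" "h \<in> Ar C" "Dom C f = Dom C g" "Dom C g = Dom C h"
    "Cod C f = Cod C g" "Cod C g = Cod C h"
  shows "f \<^bold>+ g \<^bold>+ h = f \<^bold>+ (g \<^bold>+ h)"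
proof -
  interpret comm_group "ab (Dom C f) (Cod C f)" using assms by (simp add: ab_group)
  show ?thesis
    using m_assoc[of f g h] plus_typing[of f g] assms unfolding plus_def
    by (auto simp: ab_group Hom_def)
qed

lemma plus_comm:
  assumes "f \<in> Ar C" "g \<in> Ar C" "Dom C f = Dom C g" "Cod C f = Cod C g"
  shows "f \<^bold>+ g = g \<^bold>+ f"
proof -
  interpret comm_group "ab (Dom C f) (Cod C f)" using assms by (simp add: ab_group)
  show ?thesis using m_comm[of f g] assms by (auto simp: ab_group Hom_def plus_def)
qed

text \<open>Bilinearity makes the composite idempotent for addition, hence zero.\<close>

lemma zero_Comp [simp]:
  assumes "A \<in> Ob C" "f \<in> Ar C" "Cod C f = D"
  shows "zero D A \<cdot> f = zero (Dom C f) A"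
proof -
  have D: "D \<in> Ob C" using assms by auto
  have "zero D A \<cdot> f \<^bold>+ zero D A \<cdot> f = (zero D A \<^bold>+ zero D A) \<cdot> f"
    using assms D by (subst plus_Comp) auto
  also have "\<dots> = zero D A \<cdot> f" using assms D by (subst plus_zero) auto
  finally show ?thesis using plus_idem_zero[of "zero D A \<cdot> f"] assms D by simp
qed

lemma Comp_zero [simp]:
  assumes "A \<in> Ob C" "f \<in> Ar C" "Dom C f = D"
  shows "f \<cdot> zero A D = zero A (Cod C f)"
proof -
  have D: "D \<in> Ob C" using assms by auto
  have "f \<cdot> zero A D \<^bold>+ f \<cdot> zero A D = f \<cdot> (zero A D \<^bold>+ zero A D)"
    using assms D by (subst Comp_plus) auto
  also have "\<dots> = f \<cdot> zero A D" using assms D by (subst plus_zero) auto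
  finally show ?thesis using plus_idem_zero[of "f \<cdot> zero A D"] assms D by simp
qed

text \<open>The identity and the zero endomorphism of the terminal object are both its terminal map,
  so they coincide; composing with \<open>f\<close> gives the claim.\<close>

lemma from_One_zero:
  assumes "f \<in> Ar C" "Dom C f = One C"
  shows "f = zero (One C) (Cod C f)"
proof -
  have "Id C (One C) = zero (One C) (One C)"
    using terminal_unique[of "Id C (One C)"] terminal_unique[of "zero (One C) (One C)"] by simp
  then have "f \<cdot> Id C (One C) = f \<cdot> zero (One C) (One C)" by simp
  then show ?thesis using assms by (simp del: Comp_Id_right add: Comp_Id_right[OF assms])
qed

lemma neg_typing [simp]:
  assumes "A \<in> Ob C"
  shows "neg A \<in> Ar C" "Dom C (neg A) = A" "Cod C (neg A) = A"
proof -
  interpret comm_group "ab A A" using assms by (simp add: ab_group)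
  have "Id C A \<in> carrier (ab A A)" using assms by (simp add: ab_group Hom_def)
  then have "neg A \<in> carrier (ab A A)" by (simp add: neg_def)
  then show "neg A \<in> Ar C" "Dom C (neg A) = A" "Cod C (neg A) = A"
    using assms by (auto simp: ab_group Hom_def)
qed

lemma neg_plus [simp]:
  assumes "A \<in> Ob C"
  shows "neg A \<^bold>+ Id C A = zero A A" "Id C A \<^bold>+ neg A = zero A A"
proof -
  interpret comm_group "ab A A" using assms by (simp add: ab_group)
  have I: "Id C A \<in> carrier (ab A A)" using assms by (simp add: ab_group Hom_def)
  show "neg A \<^bold>+ Id C A = zero A A" "Id C A \<^bold>+ neg A = zero A A"
    using l_inv[OF I] r_inv[OF I] neg_typing[OF assms] assms by (auto simp: plus_def)
      (auto simp: neg_def zero_def)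
qed

section \<open>Existence and uniqueness of the internal abelian group\<close>

abbreviation codiagonal :: "'o \<Rightarrow> 'a" where
  "codiagonal A \<equiv> pr1 C A A \<^bold>+ pr2 C A A"

text \<open>Composing the codiagonal with a pairing adds the two components, so the axioms reduce to
  the abelian group laws of the hom-sets.\<close>

lemma internal_abelian_group_codiagonal:
  assumes [simp]: "A \<in> Ob C"
  shows "internal_abelian_group C A (codiagonal A) (zero (One C) A) (neg A)"
  unfolding internal_abelian_group_def
proof (intro conjI)
  show "codiagonal A \<cdot> prod_arr C (codiagonal A) (Id C A) =
      codiagonal A \<cdot> prod_arr C (Id C A) (codiagonal A) \<cdot> prod_assoc C A A A"
    by (simp add: prod_assoc_def plus_assoc)
  show "codiagonal A \<cdot> prod_swap C A A = codiagonal A"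
    using plus_comm[of "pr1 C A A" "pr2 C A A"] by simp
qed (simp_all add: Hom_def)

text \<open>The unit laws force \<open>m\<close> to restrict to the identity along both biproduct
  injections, and additivity of composition recovers \<open>m\<close> from these
  restrictions.\<close>

lemma internal_abelian_group_unique:
  assumes "internal_abelian_group C A m e i"
  shows "m = codiagonal A" "e = zero (One C) A"
proof -
  note d = assms[unfolded internal_abelian_group_def]
  have [simp]: "A \<in> Ob C" "m \<in> Ar C" "Dom C m = Prd C A A" "Cod C m = A"
    "e \<in> Ar C" "Dom C e = One C" "Cod C e = A"
    using d by (auto simp: Hom_def)
  show e: "e = zero (One C) A" using from_One_zero[of e] by simp
  let ?i1 = "pair_arr C (Id C A) (zero A A)" and ?i2 = "pair_arr C (zero A A) (Id C A)"
  have 1: "m \<cdot> ?i1 = Id C A"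
  proof -
    have "m \<cdot> prod_arr C (Id C A) e \<cdot> pair_arr C (Id C A) (terminal_map C A) =
        pr1 C A (One C) \<cdot> pair_arr C (Id C A) (terminal_map C A)"
      using d by simp
    then show ?thesis by (simp add: e)
  qed
  have 2: "m \<cdot> ?i2 = Id C A"
  proof -
    have "m \<cdot> prod_arr C e (Id C A) \<cdot> pair_arr C (terminal_map C A) (Id C A) =
        pr2 C (One C) A \<cdot> pair_arr C (terminal_map C A) (Id C A)"
      using d by simp
    then show ?thesis by (simp add: e)
  qed
  \<comment> \<open>The biproduct decomposition of the identity: injection after projection, summed
    over the two factors.\<close>
  have "Id C (Prd C A A) = ?i1 \<cdot> pr1 C A A \<^bold>+ ?i2 \<cdot> pr2 C A A" (is "_ = ?s")
    by (rule pair_unique[where A = A and B = A]) simp_all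
  then have "m = m \<cdot> ?s" using Comp_Id_right[of m "Prd C A A"] by simp
  also have "\<dots> = m \<cdot> (?i1 \<cdot> pr1 C A A) \<^bold>+ m \<cdot> (?i2 \<cdot> pr2 C A A)"
    by (rule Comp_plus) auto
  also have "\<dots> = (m \<cdot> ?i1) \<cdot> pr1 C A A \<^bold>+ (m \<cdot> ?i2) \<cdot> pr2 C A A"
    by (simp del: pair_Comp)
  also have "\<dots> = codiagonal A" by (simp add: 1 2)
  finally show "m = codiagonal A" .
qed

lemma add_mult_eq:
  assumes "A \<in> Ob C" shows "add_mult C A = codiagonal A"
  unfolding add_mult_def
  using internal_abelian_group_codiagonal[OF assms]
  by (intro the_equality) (auto dest: internal_abelian_group_unique)

lemma add_unit_eq:
  assumes "A \<in> Ob C" shows "add_unit C A = zero (One C) A"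
  unfolding add_unit_def
  using internal_abelian_group_codiagonal[OF assms]
  by (intro the_equality) (auto dest: internal_abelian_group_unique)

lemma add_mult_typing [simp]:
  assumes "A \<in> Ob C"
  shows "add_mult C A \<in> Ar C" "Dom C (add_mult C A) = Prd C A A" "Cod C (add_mult C A) = A"
  using assms by (simp_all add: add_mult_eq)

lemma add_unit_typing [simp]:
  assumes "A \<in> Ob C"
  shows "add_unit C A \<in> Ar C" "Dom C (add_unit C A) = One C" "Cod C (add_unit C A) = A"
  using assms by (simp_all add: add_unit_eq)

text \<open>Arrows preserve the neutral element. The trailing \<open>h\<close> is present because
  composites are normalised to right-nested form.\<close>

lemma Comp_add_unit_Comp [simp]:
  assumes "f \<in> Ar C" "Dom C f = A" "h \<in> Ar C" "Cod C h = One C"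
  shows "f \<cdot> (add_unit C A \<cdot> h) = add_unit C (Cod C f) \<cdot> h"
  using assms by (auto simp: add_unit_eq)

section \<open>Group laws for generalised elements in the base\<close>

lemma add_arr_eq:
  assumes "f \<in> Ar C" "g \<in> Ar C" "Dom C f = Dom C g" "Cod C f = A" "Cod C g = A"
  shows "add_arr A f g = f \<^bold>+ g"
  using assms by (auto simp: add_arr_def add_mult_eq)

lemma add_arr_typing [simp]:
  assumes "f \<in> Ar C" "g \<in> Ar C" "Dom C f = Dom C g" "Cod C f = A" "Cod C g = A"
  shows "add_arr A f g \<in> Ar C" "Dom C (add_arr A f g) = Dom C g" "Cod C (add_arr A f g) = A"
  using assms by (auto simp: add_arr_eq)

lemma add_arr_Comp [simp]:
  assumes "f \<in> Ar C" "g \<in> Ar C" "Dom C f = Dom C g" "Cod C f = A" "Cod C g = A"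
    "h \<in> Ar C" "Cod C h = Dom C g"
  shows "add_arr A f g \<cdot> h = add_arr A (f \<cdot> h) (g \<cdot> h)"
  using assms by (simp add: add_arr_eq)

text \<open>By bilinearity every arrow of the base is a homomorphism of the internal groups.\<close>

lemma Comp_add_arr [simp]:
  assumes "f \<in> Ar C" "g \<in> Ar C" "Dom C f = Dom C g" "Cod C f = A" "Cod C g = A"
    "h \<in> Ar C" "Dom C h = A"
  shows "h \<cdot> add_arr A f g = add_arr (Cod C h) (h \<cdot> f) (h \<cdot> g)"
  using assms by (simp add: add_arr_eq)

lemma add_arr_assoc [simp]:
  assumes "f \<in> Ar C" "g \<in> Ar C" "h \<in> Ar C" "Dom C f = Dom C g" "Dom C g = Dom C h"
    "Cod C f = A" "Cod C g = A" "Cod C h = A"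
  shows "add_arr A (add_arr A f g) h = add_arr A f (add_arr A g h)"
  using assms by (simp add: add_arr_eq plus_assoc)

lemma add_arr_comm:
  assumes "f \<in> Ar C" "g \<in> Ar C" "Dom C f = Dom C g" "Cod C f = A" "Cod C g = A"
  shows "add_arr A f g = add_arr A g f"
  using assms plus_comm[of f g] by (simp add: add_arr_eq)

lemma add_arr_unit [simp]:
  assumes "f \<in> Ar C" "Cod C f = A" "Dom C f = D"
  shows "add_arr A (add_unit C A \<cdot> terminal_map C D) f = f"
    "add_arr A f (add_unit C A \<cdot> terminal_map C D) = f"
  using assms by (auto simp: add_arr_eq add_unit_eq)

lemma add_arr_neg [simp]:
  assumes "f \<in> Ar C" "Cod C f = A" "Dom C f = D"
  shows "add_arr A (neg A \<cdot> f) f = add_unit C A \<cdot> terminal_map C D"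
    "add_arr A f (neg A \<cdot> f) = add_unit C A \<cdot> terminal_map C D"
proof -
  have A: "A \<in> Ob C" using assms by auto
  \<comment> \<open>Pulling \<open>f\<close> out of the sum leaves the inverse law for the identity
    arrow.\<close>
  have "neg A \<cdot> f \<^bold>+ f = (neg A \<^bold>+ Id C A) \<cdot> f" "f \<^bold>+ neg A \<cdot> f = (Id C A \<^bold>+ neg A) \<cdot> f"
    using assms A by (auto simp del: neg_plus)
  then show "add_arr A (neg A \<cdot> f) f = add_unit C A \<cdot> terminal_map C D"
    "add_arr A f (neg A \<cdot> f) = add_unit C A \<cdot> terminal_map C D"
    using assms A by (auto simp: add_arr_eq add_unit_eq)
qed

end

section \<open>Cocartesian arrows\<close>

locale additive_opfibration = cartesian_monoidal_opfibration P
  for P :: "('o, 'a, 'p, 'b) opfib" +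
  fixes ab :: "'p \<Rightarrow> 'p \<Rightarrow> 'b monoid"
  assumes base_preadditive: "preadditive_structure (base P) ab"
    and terminal_cocartesian: "X \<in> Ob (total P) \<Longrightarrow> cocartesian P (terminal_map (total P) X)"
    and diagonal_cocartesian: "X \<in> Ob (total P) \<Longrightarrow> cocartesian P (diagonal_map (total P) X)"
begin

sublocale tot: finite_product_category "total P"
  by (rule total_products)

sublocale bas: preadditive_fp_category "base P" ab
  by (intro preadditive_fp_category.intro base_products preadditive_fp_category_axioms.intro base_preadditive)

abbreviation "\<X> \<equiv> total P"
abbreviation "\<B> \<equiv> base P"
abbreviation "pO \<equiv> projO P"
abbreviation "pA \<equiv> projA P"
abbreviation tcomp (infixr "\<bullet>" 70) where "g \<bullet> f \<equiv> g \<cdot>\<^bsub>total P\<^esub> f"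
abbreviation bcomp (infixr "\<star>" 70) where "g \<star> f \<equiv> g \<cdot>\<^bsub>base P\<^esub> f"

section \<open>Strict preservation of products by the projection\<close>

lemma pO_Ob [simp]: "X \<in> Ob \<X> \<Longrightarrow> pO X \<in> Ob \<B>"
  using proj_functor by (simp add: is_functor_def)

lemma pA_typing [simp]:
  assumes "f \<in> Ar \<X>"
  shows "pA f \<in> Ar \<B>" "Dom \<B> (pA f) = pO (Dom \<X> f)" "Cod \<B> (pA f) = pO (Cod \<X> f)"
  using proj_functor assms by (auto simp: is_functor_def Hom_def)

lemma pA_Id [simp]: "X \<in> Ob \<X> \<Longrightarrow> pA (Id \<X> X) = Id \<B> (pO X)"
  using proj_functor by (simp add: is_functor_def)

lemma pA_Comp [simp]:
  "\<lbrakk>f \<in> Ar \<X>; g \<in> Ar \<X>; Cod \<X> f = Dom \<X> g\<rbrakk> \<Longrightarrow> pA (g \<bullet> f) = pA g \<star> pA f"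
  using proj_functor by (simp add: is_functor_def)

lemmas proj_products [simp] = proj_One proj_Prd proj_pr1 proj_pr2

text \<open>An arrow into a product is known by its components, and the projections are preserved on
  the nose.\<close>

lemma pA_pair [simp]:
  assumes "f \<in> Ar \<X>" "g \<in> Ar \<X>" "Dom \<X> f = Dom \<X> g"
  shows "pA (pair_arr \<X> f g) = pair_arr \<B> (pA f) (pA g)"
proof (rule bas.pair_unique[where A = "pO (Cod \<X> f)" and B = "pO (Cod \<X> g)"])
  let ?A = "Cod \<X> f" and ?B = "Cod \<X> g"
  have "pA (pr1 \<X> ?A ?B) \<star> pA (pair_arr \<X> f g) = pA f"
    "pA (pr2 \<X> ?A ?B) \<star> pA (pair_arr \<X> f g) = pA g"
    using assms by (simp_all add: pA_Comp[symmetric] del: pA_Comp proj_products)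
  then show "pr1 \<B> (pO ?A) (pO ?B) \<star> pA (pair_arr \<X> f g) =
      pr1 \<B> (pO ?A) (pO ?B) \<star> pair_arr \<B> (pA f) (pA g)"
    "pr2 \<B> (pO ?A) (pO ?B) \<star> pA (pair_arr \<X> f g) =
      pr2 \<B> (pO ?A) (pO ?B) \<star> pair_arr \<B> (pA f) (pA g)"
    using assms by simp_all
qed (use assms in simp_all)

lemma pA_terminal [simp]:
  assumes "X \<in> Ob \<X>"
  shows "pA (terminal_map \<X> X) = terminal_map \<B> (pO X)"
  using bas.terminal_unique[of "pA (terminal_map \<X> X)"] assms by simp

section \<open>Factorisation through cocartesian arrows and their closure properties\<close>

lemma cocartesian_Ar: "cocartesian P u \<Longrightarrow> u \<in> Ar \<X>"
  by (simp add: cocartesian_def)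

lemma cocartesian_universal:
  assumes "cocartesian P u" "h \<in> Ar \<X>" "Dom \<X> h = Dom \<X> u" "w \<in> Ar \<B>" "Dom \<B> w = pO (Cod \<X> u)"
    "Cod \<B> w = pO (Cod \<X> h)" "w \<star> pA u = pA h"
  shows "\<exists>!v. v \<in> Hom \<X> (Cod \<X> u) (Cod \<X> h) \<and> pA v = w \<and> v \<bullet> u = h"
  using assms unfolding cocartesian_def by (simp add: Hom_def)

lemma induced_props:
  assumes "cocartesian P u" "h \<in> Ar \<X>" "Dom \<X> h = Dom \<X> u" "w \<in> Ar \<B>" "Dom \<B> w = pO (Cod \<X> u)"
    "Cod \<B> w = pO (Cod \<X> h)" "w \<star> pA u = pA h"
  shows "induced P u h w \<in> Ar \<X>" "Dom \<X> (induced P u h w) = Cod \<X> u"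
    "Cod \<X> (induced P u h w) = Cod \<X> h" "pA (induced P u h w) = w" "induced P u h w \<bullet> u = h"
  using theI'[OF cocartesian_universal[OF assms]] unfolding induced_def[symmetric] by (auto simp: Hom_def)

text \<open>The defining equation of the induced arrow, evaluated at an arbitrary generalised
  element \<open>z\<close> of the domain of \<open>u\<close>.\<close>

lemma induced_Comp:
  assumes "cocartesian P u" "h \<in> Ar \<X>" "Dom \<X> h = Dom \<X> u" "w \<in> Ar \<B>" "Dom \<B> w = pO (Cod \<X> u)"
    "Cod \<B> w = pO (Cod \<X> h)" "w \<star> pA u = pA h" "z \<in> Ar \<X>" "Cod \<X> z = Dom \<X> u"
  shows "induced P u h w \<bullet> (u \<bullet> z) = h \<bullet> z"
proof -
  have "(induced P u h w \<bullet> u) \<bullet> z = h \<bullet> z"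
    using assms by (simp only: induced_props(5))
  then show ?thesis using assms induced_props(1,2)[OF assms(1-7)] by (simp add: cocartesian_Ar)
qed

text \<open>Uniqueness in the universal property: cocartesian arrows are epic relative to the base.
  Equations between structure arrows are proved below by testing them on one suitable cocartesian
  arrow.\<close>

lemma cocartesian_cancel:
  assumes "cocartesian P u" "s \<in> Ar \<X>" "t \<in> Ar \<X>" "Dom \<X> s = Cod \<X> u" "Dom \<X> t = Cod \<X> u"
    "Cod \<X> s = Cod \<X> t" "pA s = pA t" "s \<bullet> u = t \<bullet> u"
  shows "s = t"
  using cocartesian_universal[of u "t \<bullet> u" "pA t"] assms by (auto simp: Hom_def cocartesian_Ar)

lemma cocartesian_Id [simp]: "X \<in> Ob \<X> \<Longrightarrow> cocartesian P (Id \<X> X)"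
  unfolding cocartesian_def by (auto simp: Hom_def)

text \<open>Factor twice: first through \<open>u\<close> over \<open>w \<star> pA v\<close>, then
  through \<open>v\<close> over \<open>w\<close>.\<close>

lemma cocartesian_Comp:
  assumes u: "cocartesian P u" and v: "cocartesian P v" and uv: "Cod \<X> u = Dom \<X> v"
  shows "cocartesian P (v \<bullet> u)"
  unfolding cocartesian_def
proof (intro conjI ballI impI, goal_cases)
  case 1
  show ?case using assms by (simp add: cocartesian_Ar)
next
  case (2 h w)
  note [simp] = cocartesian_Ar[OF u] cocartesian_Ar[OF v] uv
  have w: "w \<in> Ar \<B>" "Dom \<B> w = pO (Cod \<X> v)" "Cod \<B> w = pO (Cod \<X> h)"
    and h: "h \<in> Ar \<X>" "Dom \<X> h = Dom \<X> u" "(w \<star> pA v) \<star> pA u = pA h"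
    using 2 by (auto simp: Hom_def)
  obtain a where a: "a \<in> Ar \<X>" "Dom \<X> a = Dom \<X> v" "Cod \<X> a = Cod \<X> h" "pA a = w \<star> pA v" "a \<bullet> u = h"
    using ex1_implies_ex[OF cocartesian_universal[OF u, of h "w \<star> pA v"]] h w by (auto simp: Hom_def)
  obtain b where b: "b \<in> Ar \<X>" "Dom \<X> b = Cod \<X> v" "Cod \<X> b = Cod \<X> h" "pA b = w" "b \<bullet> v = a"
    using ex1_implies_ex[OF cocartesian_universal[OF v, of a w]] a w by (auto simp: Hom_def)
  show ?case
  proof (rule ex1I[of _ b])
    show "b \<in> Hom \<X> (Cod \<X> (v \<bullet> u)) (Cod \<X> h) \<and> pA b = w \<and> b \<bullet> v \<bullet> u = h"
      using a b by (auto simp: Hom_def tot.Comp_assoc_Ar[symmetric] simp del: tot.Comp_assoc_Ar)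
  next
    fix c assume c: "c \<in> Hom \<X> (Cod \<X> (v \<bullet> u)) (Cod \<X> h) \<and> pA c = w \<and> c \<bullet> v \<bullet> u = h"
    then have c': "c \<in> Ar \<X>" "Dom \<X> c = Cod \<X> v" "Cod \<X> c = Cod \<X> h" "pA c = w"
      by (auto simp: Hom_def)
    have cvu: "(c \<bullet> v) \<bullet> u = a \<bullet> u" using c a(5) c' by simp
    have cv: "c \<bullet> v = a"
      by (rule cocartesian_cancel[OF u _ _ _ _ _ _ cvu]) (simp_all add: a(1-4) c' w h(1))
    show "c = b"
      by (rule cocartesian_cancel[OF v]) (simp_all add: a(1-4) b c' w h(1) cv)
  qed
qed

text \<open>The factorisation of \<open>h\<close> through an isomorphism is
  \<open>h \<bullet> v\<close>, with \<open>v\<close> the inverse.\<close>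

lemma cocartesian_iso:
  assumes "u \<in> Ar \<X>" "v \<in> Ar \<X>" "Dom \<X> v = Cod \<X> u" "Cod \<X> v = Dom \<X> u"
    "v \<bullet> u = Id \<X> (Dom \<X> u)" "u \<bullet> v = Id \<X> (Cod \<X> u)"
  shows "cocartesian P u"
  unfolding cocartesian_def
proof (intro conjI ballI impI, goal_cases)
  case 1
  show ?case by (rule assms)
next
  case (2 h w)
  note [simp] = assms
  have w: "w \<in> Ar \<B>" "Dom \<B> w = pO (Cod \<X> u)" "Cod \<B> w = pO (Cod \<X> h)"
    and h: "h \<in> Ar \<X>" "Dom \<X> h = Dom \<X> u" "w \<star> pA u = pA h"
    using 2 by (auto simp: Hom_def)
  have uv: "pA u \<star> pA v = Id \<B> (pO (Cod \<X> u))"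
    using pA_Comp[of v u] by simp
  show ?case
  proof (rule ex1I[of _ "h \<bullet> v"])
    have "pA (h \<bullet> v) = (w \<star> pA u) \<star> pA v" using h by simp
    also have "\<dots> = w" using w uv by simp
    finally show "h \<bullet> v \<in> Hom \<X> (Cod \<X> u) (Cod \<X> h) \<and> pA (h \<bullet> v) = w \<and> (h \<bullet> v) \<bullet> u = h"
      using h by (auto simp: Hom_def)
  next
    fix c assume c: "c \<in> Hom \<X> (Cod \<X> u) (Cod \<X> h) \<and> pA c = w \<and> c \<bullet> u = h"
    then have "h \<bullet> v = (c \<bullet> u) \<bullet> v" by simp
    then show "c = h \<bullet> v" using c by (auto simp: Hom_def)
  qed
qed

lemma cocartesian_prod_pair:
  assumes "cocartesian P u" "cocartesian P v" "Dom \<X> u = A" "Dom \<X> v = B"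
  shows "cocartesian P (pair_arr \<X> (u \<bullet> pr1 \<X> A B) (v \<bullet> pr2 \<X> A B))"
  using cocartesian_prod[of u v] assms tot.prod_arr_eq[OF cocartesian_Ar cocartesian_Ar assms(3,4)] by simp

lemma lift_props [simp]:
  assumes "f \<in> Ar \<B>" "X \<in> Ob \<X>" "pO X = Dom \<B> f"
  shows "cocartesian P (lift P f X)" "lift P f X \<in> Ar \<X>" "Dom \<X> (lift P f X) = X" "pA (lift P f X) = f"
    "pO (Cod \<X> (lift P f X)) = Cod \<B> f"
proof -
  show *: "cocartesian P (lift P f X)" "lift P f X \<in> Ar \<X>" "Dom \<X> (lift P f X) = X" "pA (lift P f X) = f"
    using lift[OF assms] by (auto simp: cocartesian_def)
  show "pO (Cod \<X> (lift P f X)) = Cod \<B> f"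
    using pA_typing(3)[of "lift P f X"] * by simp
qed

text \<open>The projection factors through \<open>1 \<times> Y\<close>: first the product of a
  terminal map with an identity, then an isomorphism. Both factors are cocartesian.\<close>

lemma cocartesian_pr2 [simp]:
  assumes [simp]: "X \<in> Ob \<X>" "Y \<in> Ob \<X>"
  shows "cocartesian P (pr2 \<X> X Y)"
proof -
  have "cocartesian P (pr2 \<X> (One \<X>) Y)"
    using tot.terminal_unique[of "pr1 \<X> (One \<X>) Y"]
    by (intro cocartesian_iso[of _ "pair_arr \<X> (terminal_map \<X> Y) (Id \<X> Y)"])
      (simp_all add: eq_commute[of "pr1 _ _ _"] tot.pair_eta)
  moreover have "cocartesian P (pair_arr \<X> (terminal_map \<X> X \<bullet> pr1 \<X> X Y) (Id \<X> Y \<bullet> pr2 \<X> X Y))"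
    using terminal_cocartesian[of X] by (intro cocartesian_prod_pair) auto
  ultimately have "cocartesian P (pr2 \<X> (One \<X>) Y \<bullet> pair_arr \<X> (terminal_map \<X> X \<bullet> pr1 \<X> X Y) (Id \<X> Y
    \<bullet> pr2 \<X> X Y))"
    by (intro cocartesian_Comp) simp_all
  then show ?thesis by simp
qed

lemma cocartesian_diagonal:
  "X \<in> Ob \<X> \<Longrightarrow> cocartesian P (pair_arr \<X> (Id \<X> X) (Id \<X> X))"
  using diagonal_cocartesian[of X] by simp

subsection \<open>Vertical arrows are invertible\<close>

lemma vertical_inverse:
  assumes v: "v \<in> Ar \<X>" and pv: "pA v = Id \<B> (pO (Dom \<X> v))" and pcd: "pO (Cod \<X> v) = pO (Dom \<X> v)"
  shows "\<exists>w \<in> Ar \<X>. Dom \<X> w = Cod \<X> v \<and> Cod \<X> w = Dom \<X> v \<and> pA w = Id \<B> (pO (Dom \<X> v)) \<and>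
    w \<bullet> v = Id \<X> (Dom \<X> v) \<and> v \<bullet> w = Id \<X> (Cod \<X> v)"
proof -
  define X Y A where "X = Dom \<X> v" and "Y = Cod \<X> v" and "A = pO X"
  have [simp]: "v \<in> Ar \<X>" "Dom \<X> v = X" "Cod \<X> v = Y" "X \<in> Ob \<X>" "Y \<in> Ob \<X>" "pO X = A" "pO Y = A"
    "pA v = Id \<B> A" "A \<in> Ob \<B>"
    using assms by (auto simp: X_def Y_def A_def)
  \<comment> \<open>the Mal'cev operation \<open>(a, b, c) \<mapsto> a - b + c\<close>\<close>
  let ?q1 = "pr1 \<B> A (Prd \<B> A A)" and ?q2 = "pr1 \<B> A A \<star> pr2 \<B> A (Prd \<B> A A)"
    and ?q3 = "pr2 \<B> A A \<star> pr2 \<B> A (Prd \<B> A A)"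
  define k where "k = bas.add_arr A ?q1 (bas.add_arr A (bas.neg A \<star> ?q2) ?q3)"
  have k: "k \<in> Ar \<B>" "Dom \<B> k = Prd \<B> A (Prd \<B> A A)" "Cod \<B> k = A"
    by (auto simp: k_def)
  have k1: "k \<star> pair_arr \<B> a (pair_arr \<B> b b) = a"
    and k2: "k \<star> pair_arr \<B> a (pair_arr \<B> a b) = b"
    if [simp]: "a \<in> Ar \<B>" "b \<in> Ar \<B>" "Dom \<B> a = Dom \<B> b" "Cod \<B> a = A" "Cod \<B> b = A" for a b
    \<comment> \<open>The first pass brackets to the left, where \<open>a - a\<close> cancels and
      settles \<open>k2\<close>; the second brackets to the right, where \<open>- b + b\<close>
      cancels and settles \<open>k1\<close>.\<close>
    by (simp_all add: k_def bas.add_arr_assoc[symmetric] del: bas.add_arr_assoc)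
       (simp_all add: k_def)
  \<comment> \<open>\<open>u\<close> is the product of an identity with a diagonal,
    \<open>(a, b) \<mapsto> (a, b, b)\<close>. By \<open>k1\<close> the first projection factors
    through it over \<open>k\<close>. The last two arguments of \<open>g\<close> may live in a
    different object from the first.\<close>
  define u where "u U V = pair_arr \<X> (pr1 \<X> U V) (pair_arr \<X> (pr2 \<X> U V) (pr2 \<X> U V))" for U V
  define g where "g U V = induced P (u U V) (pr1 \<X> U V) k" for U V
  have u: "cocartesian P (u U V)" if "U \<in> Ob \<X>" "V \<in> Ob \<X>" for U V
    using cocartesian_prod_pair[of "Id \<X> U" "pair_arr \<X> (Id \<X> V) (Id \<X> V)" U V] that by
      (simp add: cocartesian_diagonal u_def)
  have g1: "g U V \<in> Ar \<X>" "Dom \<X> (g U V) = Prd \<X> U (Prd \<X> V V)" "Cod \<X> (g U V) = U" "pA (g U V) = k"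
    and g_u: "g U V \<bullet> u U V = pr1 \<X> U V"
    if "U \<in> Ob \<X>" "V \<in> Ob \<X>" "pO U = A" "pO V = A" for U V
    using induced_props[OF u[OF that(1,2)], of "pr1 \<X> U V" k] that
    unfolding g_def[symmetric] by (simp_all add: k k1 u_def)
  have g2: "g U V \<bullet> pair_arr \<X> a (pair_arr \<X> b b) = a"
    if "U \<in> Ob \<X>" "V \<in> Ob \<X>" "pO U = A" "pO V = A"
      "a \<in> Ar \<X>" "b \<in> Ar \<X>" "Dom \<X> a = Dom \<X> b" "Cod \<X> a = U" "Cod \<X> b = V" for U V a b
  proof -
    have "(g U V \<bullet> u U V) \<bullet> pair_arr \<X> a b = a"
      unfolding g_u[OF that(1-4)] using that by simp
    then show ?thesis using that by (simp add: g1 u_def)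
  qed
  note g = g1 g2
  \<comment> \<open>The formula \<open>a - v a + b\<close>. By \<open>k2\<close> it lies over the
    second projection, hence factors through \<open>pr2 \<X> X Y\<close> by a vertical
    arrow.\<close>
  let ?h = "g X Y \<bullet> pair_arr \<X> (pr1 \<X> X Y) (pair_arr \<X> (v \<bullet> pr1 \<X> X Y) (pr2 \<X> X Y))"
  define w where "w = induced P (pr2 \<X> X Y) ?h (Id \<B> A)"
  have "w \<in> Ar \<X>" "Dom \<X> w = Y" "Cod \<X> w = X" "pA w = Id \<B> A" and w2: "w \<bullet> pr2 \<X> X Y = ?h"
    unfolding w_def
    using induced_props[of "pr2 \<X> X Y" ?h "Id \<B> A"] by (auto simp: g k2)
  note [simp] = this(1-4)
  \<comment> \<open>The value of \<open>w\<close> at \<open>b\<close> can be computed with any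
    auxiliary element \<open>a\<close> of \<open>X\<close> at the same stage.\<close>
  have w: "w \<bullet> b = g X Y \<bullet> pair_arr \<X> a (pair_arr \<X> (v \<bullet> a) b)"
    if "a \<in> Ar \<X>" "b \<in> Ar \<X>" "Dom \<X> a = Dom \<X> b" "Cod \<X> a = X" "Cod \<X> b = Y" for a b
  proof -
    have "(w \<bullet> pr2 \<X> X Y) \<bullet> pair_arr \<X> a b = g X Y \<bullet> pair_arr \<X> a (pair_arr \<X> (v \<bullet> a) b)"
      unfolding w2 using that by (simp add: g)
    then show ?thesis using that by simp
  qed
  \<comment> \<open>Naturality of \<open>g\<close> in its last two arguments: on
    \<open>(a, b, b)\<close> both sides return \<open>a\<close>.\<close>
  have g_nat: "g X Y \<bullet> pair_arr \<X> a (pair_arr \<X> (v \<bullet> b) (v \<bullet> c)) = g X X \<bullet> pair_arr \<X> a (pair_arr \<X> b c)"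
    if "a \<in> Ar \<X>" "b \<in> Ar \<X>" "c \<in> Ar \<X>" "Dom \<X> a = Dom \<X> b" "Dom \<X> b = Dom \<X> c"
      "Cod \<X> a = X" "Cod \<X> b = X" "Cod \<X> c = X" for a b c
  proof -
    let ?p1 = "pr1 \<X> X (Prd \<X> X X)" and ?p2 = "pr2 \<X> X (Prd \<X> X X)"
    let ?vv = "pair_arr \<X> ?p1 (pair_arr \<X> (v \<bullet> (pr1 \<X> X X \<bullet> ?p2)) (v \<bullet> (pr2 \<X> X X \<bullet> ?p2)))"
    have "g X Y \<bullet> ?vv = g X X"
      by (rule cocartesian_cancel[OF u[of X X]]) (simp_all add: g k u_def bas.pair_eta)
    then have "(g X Y \<bullet> ?vv) \<bullet> pair_arr \<X> a (pair_arr \<X> b c) = g X X \<bullet> pair_arr \<X> a (pair_arr \<X> b c)"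
      by simp
    then show ?thesis using that by (simp add: g)
  qed
  \<comment> \<open>Naturality of \<open>g\<close> in its first argument: on
    \<open>(a, b, b)\<close> both sides return \<open>v a\<close>.\<close>
  have g_out: "v \<bullet> (g X Y \<bullet> pair_arr \<X> a (pair_arr \<X> b c)) = g Y Y \<bullet> pair_arr \<X> (v \<bullet> a) (pair_arr \<X> b c)"
    if "a \<in> Ar \<X>" "b \<in> Ar \<X>" "c \<in> Ar \<X>" "Dom \<X> a = Dom \<X> b" "Dom \<X> b = Dom \<X> c"
      "Cod \<X> a = X" "Cod \<X> b = Y" "Cod \<X> c = Y" for a b c
  proof -
    let ?p1 = "pr1 \<X> X (Prd \<X> Y Y)" and ?p2 = "pr2 \<X> X (Prd \<X> Y Y)"
    let ?vv = "pair_arr \<X> (v \<bullet> ?p1) ?p2"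
    have "v \<bullet> g X Y = g Y Y \<bullet> ?vv"
      by (rule cocartesian_cancel[OF u[of X Y]]) (simp_all add: g k u_def bas.pair_eta)
    then have "(v \<bullet> g X Y) \<bullet> pair_arr \<X> a (pair_arr \<X> b c) = (g Y Y \<bullet> ?vv) \<bullet> pair_arr \<X> a (pair_arr \<X> b c)"
      by simp
    then show ?thesis using that by (simp add: g)
  qed
  \<comment> \<open>The second Mal'cev identity in the total category. Both sides lie over the same
    base arrow by \<open>k2\<close> and agree on the cocartesian diagonal, where the first identity
    applies.\<close>
  have g_diag: "g U U \<bullet> pair_arr \<X> a (pair_arr \<X> a b) = b"
    if [simp]: "U \<in> Ob \<X>" "pO U = A" and ab: "a \<in> Ar \<X>" "b \<in> Ar \<X>" "Dom \<X> a = Dom \<X> b" "Cod \<X> a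
      = U" "Cod \<X> b = U"
    for U a b
  proof -
    have "g U U \<bullet> pair_arr \<X> (pr1 \<X> U U) (pair_arr \<X> (pr1 \<X> U U) (pr2 \<X> U U)) = pr2 \<X> U U"
      by (rule cocartesian_cancel[OF cocartesian_diagonal[of U]]) (simp_all add: g k2)
    then have "(g U U \<bullet> pair_arr \<X> (pr1 \<X> U U) (pair_arr \<X> (pr1 \<X> U U) (pr2 \<X> U U))) \<bullet> pair_arr \<X> a b =
        pr2 \<X> U U \<bullet> pair_arr \<X> a b"
      by simp
    then show ?thesis using ab by (simp add: g)
  qed
  \<comment> \<open>On elements: \<open>w (v b) = g (a, v a, v b) = g (a, a, b) = b\<close>.\<close>
  have "w \<bullet> v = Id \<X> X"
    by (rule cocartesian_cancel[OF cocartesian_pr2[of X X]])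
      (simp_all add: w[of "pr1 \<X> X X" "v \<bullet> pr2 \<X> X X"] g_nat g_diag)
  \<comment> \<open>On elements:
    \<open>v (w b) = v (g (a, v a, b)) = g (v a, v a, b) = b\<close>.\<close>
  moreover have "v \<bullet> w = Id \<X> Y"
    by (rule cocartesian_cancel[OF cocartesian_pr2[of X Y]])
      (simp_all add: w[of "pr1 \<X> X Y" "pr2 \<X> X Y"] g_out g_diag)
  ultimately show ?thesis by (intro bexI[of _ w]) auto
qed

section \<open>Generalised elements of the fibres\<close>

lemma fibre_simps [simp]:
  "X \<in> Ob (fibre P A) \<longleftrightarrow> X \<in> Ob \<X> \<and> pO X = A"
  "v \<in> Ar (fibre P A) \<longleftrightarrow> v \<in> Ar \<X> \<and> pO (Dom \<X> v) = A \<and> pO (Cod \<X> v) = A \<and> pA v = Id \<B> A"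
  "Dom (fibre P A) = Dom \<X>" "Cod (fibre P A) = Cod \<X>" "Id (fibre P A) = Id \<X>"
  "Comp (fibre P A) = Comp \<X>"
  by (auto simp: fibre_def)

lemma fibre_sm_simps [simp]:
  "Ob (fibre_sm P A) = Ob (fibre P A)" "Ar (fibre_sm P A) = Ar (fibre P A)"
  "Dom (fibre_sm P A) = Dom \<X>" "Cod (fibre_sm P A) = Cod \<X>" "Id (fibre_sm P A) = Id \<X>"
  "Comp (fibre_sm P A) = Comp \<X>"
  "Ten (fibre_sm P A) = fibre_ten P A" "Unt (fibre_sm P A) = fibre_unit P A"
  "Asc (fibre_sm P A) = fibre_assoc P A" "LUn (fibre_sm P A) = fibre_lunit P A"
  "RUn (fibre_sm P A) = fibre_runit P A" "Sym (fibre_sm P A) = fibre_sym P A"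
  by (simp_all add: fibre_sm_def cat.defs sm_cat.defs fibre_def)

lemma truncate_fibre_sm [simp]: "cat.truncate (fibre_sm P A) = fibre P A"
  by (simp add: fibre_sm_def cat.defs sm_cat.defs fibre_def)

lemma category_fibre:
  assumes "A \<in> Ob \<B>"
  shows "category (fibre P A)" "category (fibre_sm P A)"
  using assms by (auto simp: category_def Hom_def)

text \<open>The inverse supplied by \<open>vertical_inverse\<close> is again vertical, so it belongs
  to the fibre. This settles invertibility of all structure and comparison arrows at once.\<close>

lemma fibre_iso:
  assumes "v \<in> Ar (fibre P A)"
  shows "is_iso (fibre P A) v" "is_iso (fibre_sm P A) v"
  using vertical_inverse[of v] assms by (auto simp: is_iso_def Hom_def)

text \<open>Carries a generalised element \<open>a : Z \<rightarrow> X\<close> to one of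
  \<open>f_* X\<close> lying over \<open>f \<star> pA a\<close>.\<close>

definition push :: "'b \<Rightarrow> 'a \<Rightarrow> 'a" where
  "push f a = lift P f (Cod \<X> a) \<bullet> a"

lemma change_of_base_Ob [simp]:
  assumes "f \<in> Ar \<B>" "X \<in> Ob \<X>" "pO X = Dom \<B> f"
  shows "FO (change_of_base P f) X \<in> Ob \<X>" "pO (FO (change_of_base P f) X) = Cod \<B> f"
  using assms by (auto simp: change_of_base_def)

lemma lift_Cod [simp]: "Cod \<X> (lift P f X) = FO (change_of_base P f) X"
  by (simp add: change_of_base_def)

lemma push_typing [simp]:
  assumes "f \<in> Ar \<B>" "a \<in> Ar \<X>" "pO (Cod \<X> a) = Dom \<B> f"
  shows "push f a \<in> Ar \<X>" "Dom \<X> (push f a) = Dom \<X> a"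
    "Cod \<X> (push f a) = FO (change_of_base P f) (Cod \<X> a)" "pA (push f a) = f \<star> pA a"
  using assms by (simp_all add: push_def)

lemma push_Comp [simp]:
  assumes "f \<in> Ar \<B>" "a \<in> Ar \<X>" "pO (Cod \<X> a) = Dom \<B> f" "z \<in> Ar \<X>" "Cod \<X> z = Dom \<X> a"
  shows "push f a \<bullet> z = push f (a \<bullet> z)"
  using assms by (simp add: push_def)

lemma lift_Comp [simp]:
  assumes "Cod \<X> a = X"
  shows "lift P f X \<bullet> a = push f a"
  using assms by (simp add: push_def)

text \<open>The chosen lift is the image of the universal element of \<open>X\<close>; equality of
  arrows out of \<open>f_* X\<close> is tested on it.\<close>

lemma push_Id:
  assumes "f \<in> Ar \<B>" "X \<in> Ob \<X>" "pO X = Dom \<B> f"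
  shows "push f (Id \<X> X) = lift P f X"
  using assms by (simp add: push_def del: lift_Comp)

lemma cocartesian_push [simp]:
  assumes "cocartesian P a" "f \<in> Ar \<B>" "pO (Cod \<X> a) = Dom \<B> f"
  shows "cocartesian P (push f a)"
  using assms cocartesian_Ar[OF assms(1)] unfolding push_def by (intro cocartesian_Comp) simp_all

lemma change_of_base_Ar:
  assumes "f \<in> Ar \<B>" "v \<in> Ar \<X>" "pO (Dom \<X> v) = Dom \<B> f" "pO (Cod \<X> v) = Dom \<B> f" "pA v = Id \<B> (Dom \<B> f)"
  shows "FA (change_of_base P f) v \<in> Ar \<X>"
    "Dom \<X> (FA (change_of_base P f) v) = FO (change_of_base P f) (Dom \<X> v)"
    "Cod \<X> (FA (change_of_base P f) v) = FO (change_of_base P f) (Cod \<X> v)"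
    "pA (FA (change_of_base P f) v) = Id \<B> (Cod \<B> f)"
    "FA (change_of_base P f) v \<bullet> lift P f (Dom \<X> v) = push f v"
proof -
  have eq: "FA (change_of_base P f) v = induced P (lift P f (Dom \<X> v)) (push f v) (Id \<B> (Cod \<B> f))"
    by (simp add: change_of_base_def push_def del: lift_Cod lift_Comp)
  show "FA (change_of_base P f) v \<in> Ar \<X>"
    "Dom \<X> (FA (change_of_base P f) v) = FO (change_of_base P f) (Dom \<X> v)"
    "Cod \<X> (FA (change_of_base P f) v) = FO (change_of_base P f) (Cod \<X> v)"
    "pA (FA (change_of_base P f) v) = Id \<B> (Cod \<B> f)"
    "FA (change_of_base P f) v \<bullet> lift P f (Dom \<X> v) = push f v"
    unfolding eq
    using induced_props[of "lift P f (Dom \<X> v)" "push f v" "Id \<B> (Cod \<B> f)"] assms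
    by simp_all
qed

text \<open>Describes \<open>f_* v\<close> by its action on pushed elements, obtained by
  precomposing its defining equation with \<open>a\<close>.\<close>

lemma change_of_base_psh [simp]:
  assumes "f \<in> Ar \<B>" "v \<in> Ar \<X>" "pO (Dom \<X> v) = Dom \<B> f" "pO (Cod \<X> v) = Dom \<B> f" "pA v = Id \<B> (Dom \<B> f)"
    "a \<in> Ar \<X>" "Cod \<X> a = Dom \<X> v"
  shows "FA (change_of_base P f) v \<bullet> push f a = push f (v \<bullet> a)"
proof -
  note c = change_of_base_Ar[OF assms(1-5)]
  have "(FA (change_of_base P f) v \<bullet> lift P f (Dom \<X> v)) \<bullet> a = push f v \<bullet> a"
    by (simp only: c)
  then show ?thesis using assms c(1-4) by simp
qed

lemmas change_of_base_Ar_simps [simp] = change_of_base_Ar(1-4)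

text \<open>\<open>tensor_arr A a b\<close> is the product \<open>a \<cdot> b\<close> of generalised elements, and \<open>unit_arr A Z\<close> its unit at stage \<open>Z\<close>.\<close>

definition tensor_arr :: "'p \<Rightarrow> 'a \<Rightarrow> 'a \<Rightarrow> 'a" where
  "tensor_arr A a b = push (add_mult \<B> A) (pair_arr \<X> a b)"

definition unit_arr :: "'p \<Rightarrow> 'o \<Rightarrow> 'a" where
  "unit_arr A Z = push (add_unit \<B> A) (terminal_map \<X> Z)"

lemma fibre_ten_Ob [simp]:
  assumes "X \<in> Ob \<X>" "Y \<in> Ob \<X>" "pO X = A" "pO Y = A"
  shows "FO (fibre_ten P A) (X, Y) \<in> Ob \<X>" "pO (FO (fibre_ten P A) (X, Y)) = A"
  using assms by (auto simp: fibre_ten_def comp_functor_def lax_prod_def)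

lemma fibre_unit_Ob [simp]:
  assumes "A \<in> Ob \<B>"
  shows "fibre_unit P A \<in> Ob \<X>" "pO (fibre_unit P A) = A"
  using assms by (auto simp: fibre_unit_def)

lemma tensor_arr_typing [simp]:
  assumes "a \<in> Ar \<X>" "b \<in> Ar \<X>" "Dom \<X> a = Dom \<X> b" "pO (Cod \<X> a) = A" "pO (Cod \<X> b) = A"
  shows "tensor_arr A a b \<in> Ar \<X>" "Dom \<X> (tensor_arr A a b) = Dom \<X> b"
    "Cod \<X> (tensor_arr A a b) = FO (fibre_ten P A) (Cod \<X> a, Cod \<X> b)"
    "pA (tensor_arr A a b) = bas.add_arr A (pA a) (pA b)"
proof -
  have "A \<in> Ob \<B>" using assms by auto
  with assms show "tensor_arr A a b \<in> Ar \<X>" "Dom \<X> (tensor_arr A a b) = Dom \<X> b"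
    "Cod \<X> (tensor_arr A a b) = FO (fibre_ten P A) (Cod \<X> a, Cod \<X> b)"
    "pA (tensor_arr A a b) = bas.add_arr A (pA a) (pA b)"
    by (simp_all add: tensor_arr_def fibre_ten_def comp_functor_def lax_prod_def bas.add_arr_def)
qed

lemma tensor_arr_Comp [simp]:
  assumes "a \<in> Ar \<X>" "b \<in> Ar \<X>" "Dom \<X> a = Dom \<X> b" "pO (Cod \<X> a) = A" "pO (Cod \<X> b) = A"
    "z \<in> Ar \<X>" "Cod \<X> z = Dom \<X> b"
  shows "tensor_arr A a b \<bullet> z = tensor_arr A (a \<bullet> z) (b \<bullet> z)"
proof -
  have "A \<in> Ob \<B>" using assms by auto
  with assms show ?thesis by (simp add: tensor_arr_def)
qed

lemma unit_arr_typing [simp]: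
  assumes "Z \<in> Ob \<X>" "A \<in> Ob \<B>"
  shows "unit_arr A Z \<in> Ar \<X>" "Dom \<X> (unit_arr A Z) = Z" "Cod \<X> (unit_arr A Z) = fibre_unit P A"
    "pA (unit_arr A Z) = add_unit \<B> A \<star> terminal_map \<B> (pO Z)"
  using assms by (simp_all add: unit_arr_def fibre_unit_def)

lemma unit_arr_Comp [simp]:
  assumes "Z \<in> Ob \<X>" "A \<in> Ob \<B>" "z \<in> Ar \<X>" "Cod \<X> z = Z"
  shows "unit_arr A Z \<bullet> z = unit_arr A (Dom \<X> z)"
  using assms by (simp add: unit_arr_def)

text \<open>The chosen lift over the multiplication is the product of the two universal elements at
  stage \<open>X \<times> Y\<close>.\<close>

lemma ten_lift_eq:
  assumes "X \<in> Ob \<X>" "Y \<in> Ob \<X>" "pO X = A" "pO Y = A"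
  shows "ten_lift P A X Y = tensor_arr A (pr1 \<X> X Y) (pr2 \<X> X Y)"
  using assms bas.add_mult_typing[of A] by (auto simp add: ten_lift_def tensor_arr_def tot.pair_eta push_Id)

lemma unit_lift_eq:
  assumes "A \<in> Ob \<B>"
  shows "unit_lift P A = unit_arr A (One \<X>)"
  using assms tot.terminal_unique[of "Id \<X> (One \<X>)"] by (simp add: unit_lift_def unit_arr_def flip: push_Id)

text \<open>The product at the generic stage \<open>Dom a \<times> Dom b\<close>.\<close>

definition gen_tensor :: "'p \<Rightarrow> 'a \<Rightarrow> 'a \<Rightarrow> 'a" where
  "gen_tensor A a b = tensor_arr A (a \<bullet> pr1 \<X> (Dom \<X> a) (Dom \<X> b)) (b \<bullet> pr2 \<X> (Dom \<X> a) (Dom \<X> b))"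

lemma gen_tensor_typing [simp]:
  assumes "a \<in> Ar \<X>" "b \<in> Ar \<X>" "pO (Cod \<X> a) = A" "pO (Cod \<X> b) = A"
  shows "gen_tensor A a b \<in> Ar \<X>" "Dom \<X> (gen_tensor A a b) = Prd \<X> (Dom \<X> a) (Dom \<X> b)"
    "Cod \<X> (gen_tensor A a b) = FO (fibre_ten P A) (Cod \<X> a, Cod \<X> b)"
  using assms by (simp_all add: gen_tensor_def)

text \<open>A product of cocartesian arrows followed by a lift. By iteration, bracketed words in
  independent generic elements serve as test arrows.\<close>

lemma cocartesian_gen_tensor [simp]:
  assumes "cocartesian P a" "cocartesian P b" "pO (Cod \<X> a) = A" "pO (Cod \<X> b) = A"
  shows "cocartesian P (gen_tensor A a b)"
proof -
  note [simp] = cocartesian_Ar[OF assms(1)] cocartesian_Ar[OF assms(2)]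
  have "A \<in> Ob \<B>" using assms by auto
  with assms show ?thesis
    unfolding gen_tensor_def tensor_arr_def by (intro cocartesian_push cocartesian_prod_pair) simp_all
qed

lemma cocartesian_unit_arr [simp]:
  assumes "Z \<in> Ob \<X>" "A \<in> Ob \<B>"
  shows "cocartesian P (unit_arr A Z)"
  using assms terminal_cocartesian[of Z] by (simp add: unit_arr_def)

lemma fibre_ten_Ar [simp]:
  assumes "v \<in> Ar (fibre P A)" "w \<in> Ar (fibre P A)"
  shows "FA (fibre_ten P A) (v, w) \<in> Ar \<X>"
    "Dom \<X> (FA (fibre_ten P A) (v, w)) = FO (fibre_ten P A) (Dom \<X> v, Dom \<X> w)"
    "Cod \<X> (FA (fibre_ten P A) (v, w)) = FO (fibre_ten P A) (Cod \<X> v, Cod \<X> w)"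
    "pA (FA (fibre_ten P A) (v, w)) = Id \<B> A"
    "\<lbrakk>a \<in> Ar \<X>; b \<in> Ar \<X>; Dom \<X> a = Dom \<X> b; Cod \<X> a = Dom \<X> v; Cod \<X> b = Dom \<X> w\<rbrakk> \<Longrightarrow>
      FA (fibre_ten P A) (v, w) \<bullet> tensor_arr A a b = tensor_arr A (v \<bullet> a) (w \<bullet> b)"
proof -
  have "A \<in> Ob \<B>" using assms by auto
  \<comment> \<open>A product of vertical arrows projects to the pairing of the two base
    projections; \<open>pair_eta\<close> turns this into the identity of
    \<open>A \<times> A\<close>.\<close>
  with assms bas.pair_eta[of A A]
  show "FA (fibre_ten P A) (v, w) \<in> Ar \<X>"
    "Dom \<X> (FA (fibre_ten P A) (v, w)) = FO (fibre_ten P A) (Dom \<X> v, Dom \<X> w)"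
    "Cod \<X> (FA (fibre_ten P A) (v, w)) = FO (fibre_ten P A) (Cod \<X> v, Cod \<X> w)"
    "pA (FA (fibre_ten P A) (v, w)) = Id \<B> A"
    "\<lbrakk>a \<in> Ar \<X>; b \<in> Ar \<X>; Dom \<X> a = Dom \<X> b; Cod \<X> a = Dom \<X> v; Cod \<X> b = Dom \<X> w\<rbrakk> \<Longrightarrow>
      FA (fibre_ten P A) (v, w) \<bullet> tensor_arr A a b = tensor_arr A (v \<bullet> a) (w \<bullet> b)"
    by (simp_all add: fibre_ten_def comp_functor_def lax_prod_def tensor_arr_def)
qed

text \<open>The two defining composites are the words \<open>(p q) r\<close> and
  \<open>p (q r)\<close> in the projections of \<open>(X \<times> Y) \<times> Z\<close>, over the
  same base arrow by associativity. Every triple of elements is obtained from this universal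
  one.\<close>

lemma fibre_assoc [simp]:
  assumes ob: "X \<in> Ob \<X>" "Y \<in> Ob \<X>" "Z \<in> Ob \<X>" "pO X = A" "pO Y = A" "pO Z = A"
  shows "fibre_assoc P A X Y Z \<in> Ar \<X>"
    "Dom \<X> (fibre_assoc P A X Y Z) = FO (fibre_ten P A) (FO (fibre_ten P A) (X, Y), Z)"
    "Cod \<X> (fibre_assoc P A X Y Z) = FO (fibre_ten P A) (X, FO (fibre_ten P A) (Y, Z))"
    "pA (fibre_assoc P A X Y Z) = Id \<B> A"
    "\<lbrakk>a \<in> Ar \<X>; b \<in> Ar \<X>; c \<in> Ar \<X>; Dom \<X> a = Dom \<X> b; Dom \<X> b = Dom \<X> c;
      Cod \<X> a = X; Cod \<X> b = Y; Cod \<X> c = Z\<rbrakk> \<Longrightarrow>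
      fibre_assoc P A X Y Z \<bullet> tensor_arr A (tensor_arr A a b) c = tensor_arr A a (tensor_arr A b c)"
proof -
  have A: "A \<in> Ob \<B>" using assms by auto
  let ?p = "pr1 \<X> X Y \<bullet> pr1 \<X> (Prd \<X> X Y) Z" and ?q = "pr2 \<X> X Y \<bullet> pr1 \<X> (Prd \<X> X Y) Z"
    and ?r = "pr2 \<X> (Prd \<X> X Y) Z"
  let ?u = "tensor_arr A (tensor_arr A ?p ?q) ?r" and ?h = "tensor_arr A ?p (tensor_arr A ?q ?r)"
  have "cocartesian P (gen_tensor A (gen_tensor A (Id \<X> X) (Id \<X> Y)) (Id \<X> Z))"
    using ob by simp
  then have u: "cocartesian P ?u"
    using ob by (simp add: gen_tensor_def)
  have eq: "fibre_assoc P A X Y Z = induced P ?u ?h (Id \<B> A)"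
    unfolding fibre_assoc_def using ob A by (simp add: prod_assoc_def ten_lift_eq)
  note i = induced_props[OF u, of ?h "Id \<B> A"] induced_Comp[OF u, of ?h "Id \<B> A"]
  show "fibre_assoc P A X Y Z \<in> Ar \<X>"
    "Dom \<X> (fibre_assoc P A X Y Z) = FO (fibre_ten P A) (FO (fibre_ten P A) (X, Y), Z)"
    "Cod \<X> (fibre_assoc P A X Y Z) = FO (fibre_ten P A) (X, FO (fibre_ten P A) (Y, Z))"
    "pA (fibre_assoc P A X Y Z) = Id \<B> A"
    unfolding eq using i(1-4) ob A by simp_all
  show "fibre_assoc P A X Y Z \<bullet> tensor_arr A (tensor_arr A a b) c = tensor_arr A a (tensor_arr A b c)"
    if "a \<in> Ar \<X>" "b \<in> Ar \<X>" "c \<in> Ar \<X>" "Dom \<X> a = Dom \<X> b" "Dom \<X> b = Dom \<X> c"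
      "Cod \<X> a = X" "Cod \<X> b = Y" "Cod \<X> c = Z"
    unfolding eq using i(6)[of "pair_arr \<X> (pair_arr \<X> a b) c"] that ob A by simp
qed

text \<open>The zero law in the base makes the two defining composites lie over the same arrow; the
  pairing of the terminal map with \<open>a\<close> then specialises the equation to any
  stage.\<close>

lemma fibre_lunit [simp]:
  assumes ob: "X \<in> Ob \<X>" "pO X = A"
  shows "fibre_lunit P A X \<in> Ar \<X>"
    "Dom \<X> (fibre_lunit P A X) = FO (fibre_ten P A) (fibre_unit P A, X)"
    "Cod \<X> (fibre_lunit P A X) = X"
    "pA (fibre_lunit P A X) = Id \<B> A"
    "\<lbrakk>a \<in> Ar \<X>; Dom \<X> a = Z; Cod \<X> a = X\<rbrakk> \<Longrightarrow>
      fibre_lunit P A X \<bullet> tensor_arr A (unit_arr A Z) a = a"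
proof -
  have A: "A \<in> Ob \<B>" using assms by auto
  let ?u = "tensor_arr A (unit_arr A (Prd \<X> (One \<X>) X)) (pr2 \<X> (One \<X>) X)"
  have u: "cocartesian P ?u"
    using cocartesian_gen_tensor[of "unit_arr A (One \<X>)" "Id \<X> X" A] ob A by (simp add: gen_tensor_def)
  have eq: "fibre_lunit P A X = induced P ?u (pr2 \<X> (One \<X>) X) (Id \<B> A)"
    unfolding fibre_lunit_def using ob A by (simp add: ten_lift_eq unit_lift_eq)
  note i = induced_props[OF u, of "pr2 \<X> (One \<X>) X" "Id \<B> A"]
    induced_Comp[OF u, of "pr2 \<X> (One \<X>) X" "Id \<B> A"]
  show "fibre_lunit P A X \<in> Ar \<X>"
    "Dom \<X> (fibre_lunit P A X) = FO (fibre_ten P A) (fibre_unit P A, X)"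
    "Cod \<X> (fibre_lunit P A X) = X"
    "pA (fibre_lunit P A X) = Id \<B> A"
    unfolding eq using i(1-4) ob A by simp_all
  show "fibre_lunit P A X \<bullet> tensor_arr A (unit_arr A Z) a = a"
    if "a \<in> Ar \<X>" "Dom \<X> a = Z" "Cod \<X> a = X"
    unfolding eq using i(6)[of "pair_arr \<X> (terminal_map \<X> Z) a"] that ob A by auto
qed

lemma fibre_runit [simp]:
  assumes ob: "X \<in> Ob \<X>" "pO X = A"
  shows "fibre_runit P A X \<in> Ar \<X>"
    "Dom \<X> (fibre_runit P A X) = FO (fibre_ten P A) (X, fibre_unit P A)"
    "Cod \<X> (fibre_runit P A X) = X"
    "pA (fibre_runit P A X) = Id \<B> A"
    "\<lbrakk>a \<in> Ar \<X>; Dom \<X> a = Z; Cod \<X> a = X\<rbrakk> \<Longrightarrow>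
      fibre_runit P A X \<bullet> tensor_arr A a (unit_arr A Z) = a"
proof -
  have A: "A \<in> Ob \<B>" using assms by auto
  let ?u = "tensor_arr A (pr1 \<X> X (One \<X>)) (unit_arr A (Prd \<X> X (One \<X>)))"
  have u: "cocartesian P ?u"
    using cocartesian_gen_tensor[of "Id \<X> X" "unit_arr A (One \<X>)" A] ob A by (simp add: gen_tensor_def)
  have eq: "fibre_runit P A X = induced P ?u (pr1 \<X> X (One \<X>)) (Id \<B> A)"
    unfolding fibre_runit_def using ob A by (simp add: ten_lift_eq unit_lift_eq)
  note i = induced_props[OF u, of "pr1 \<X> X (One \<X>)" "Id \<B> A"]
    induced_Comp[OF u, of "pr1 \<X> X (One \<X>)" "Id \<B> A"]
  show "fibre_runit P A X \<in> Ar \<X>"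
    "Dom \<X> (fibre_runit P A X) = FO (fibre_ten P A) (X, fibre_unit P A)"
    "Cod \<X> (fibre_runit P A X) = X"
    "pA (fibre_runit P A X) = Id \<B> A"
    unfolding eq using i(1-4) ob A by simp_all
  show "fibre_runit P A X \<bullet> tensor_arr A a (unit_arr A Z) = a"
    if "a \<in> Ar \<X>" "Dom \<X> a = Z" "Cod \<X> a = X"
    unfolding eq using i(6)[of "pair_arr \<X> a (terminal_map \<X> Z)"] that ob A by auto
qed

lemma fibre_sym [simp]:
  assumes ob: "X \<in> Ob \<X>" "Y \<in> Ob \<X>" "pO X = A" "pO Y = A"
  shows "fibre_sym P A X Y \<in> Ar \<X>"
    "Dom \<X> (fibre_sym P A X Y) = FO (fibre_ten P A) (X, Y)"
    "Cod \<X> (fibre_sym P A X Y) = FO (fibre_ten P A) (Y, X)"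
    "pA (fibre_sym P A X Y) = Id \<B> A"
    "\<lbrakk>a \<in> Ar \<X>; b \<in> Ar \<X>; Dom \<X> a = Dom \<X> b; Cod \<X> a = X; Cod \<X> b = Y\<rbrakk> \<Longrightarrow>
      fibre_sym P A X Y \<bullet> tensor_arr A a b = tensor_arr A b a"
proof -
  have A: "A \<in> Ob \<B>" using assms by auto
  let ?u = "tensor_arr A (pr1 \<X> X Y) (pr2 \<X> X Y)" and ?h = "tensor_arr A (pr2 \<X> X Y) (pr1 \<X> X Y)"
  have u: "cocartesian P ?u"
    using cocartesian_gen_tensor[of "Id \<X> X" "Id \<X> Y" A] ob by (simp add: gen_tensor_def)
  have eq: "fibre_sym P A X Y = induced P ?u ?h (Id \<B> A)"
    unfolding fibre_sym_def using ob A by (simp add: ten_lift_eq)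
  note i = induced_props[OF u, of ?h "Id \<B> A"] induced_Comp[OF u, of ?h "Id \<B> A"]
  \<comment> \<open>Commutativity would loop as a rewrite rule, so the one needed instance is
    stated.\<close>
  have comm: "bas.add_arr A (pr1 \<B> A A) (pr2 \<B> A A) = bas.add_arr A (pr2 \<B> A A) (pr1 \<B> A A)"
    using A by (intro bas.add_arr_comm) simp_all
  show "fibre_sym P A X Y \<in> Ar \<X>"
    "Dom \<X> (fibre_sym P A X Y) = FO (fibre_ten P A) (X, Y)"
    "Cod \<X> (fibre_sym P A X Y) = FO (fibre_ten P A) (Y, X)"
    "pA (fibre_sym P A X Y) = Id \<B> A"
    unfolding eq using i(1-4) ob A by (simp_all add: comm)
  show "fibre_sym P A X Y \<bullet> tensor_arr A a b = tensor_arr A b a"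
    if "a \<in> Ar \<X>" "b \<in> Ar \<X>" "Dom \<X> a = Dom \<X> b" "Cod \<X> a = X" "Cod \<X> b = Y"
    unfolding eq using i(6)[of "pair_arr \<X> a b"] that ob A by (simp add: comm)
qed

section \<open>The pseudofunctor\<close>

text \<open>The comparison \<open>g_* (f_* X) \<rightarrow> (g \<star> f)_* X\<close>, named so that
  it can be rewritten by its effect on pushed elements.\<close>

definition base_change_comp :: "'b \<Rightarrow> 'b \<Rightarrow> 'o \<Rightarrow> 'a" where
  "base_change_comp g f X = PComp (associated_pseudofunctor P) g f X"

lemma base_change_comp [simp]:
  assumes "f \<in> Ar \<B>" "g \<in> Ar \<B>" "Cod \<B> f = Dom \<B> g" "X \<in> Ob \<X>" "pO X = Dom \<B> f"
  shows "base_change_comp g f X \<in> Ar \<X>"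
    "Dom \<X> (base_change_comp g f X) = FO (change_of_base P g) (FO (change_of_base P f) X)"
    "Cod \<X> (base_change_comp g f X) = FO (change_of_base P (g \<star> f)) X"
    "pA (base_change_comp g f X) = Id \<B> (Cod \<B> g)"
    "\<lbrakk>a \<in> Ar \<X>; Cod \<X> a = X\<rbrakk> \<Longrightarrow> base_change_comp g f X \<bullet> push g (push f a) = push (g \<star> f) a"
proof -
  let ?u = "push g (push f (Id \<X> X))" and ?h = "push (g \<star> f) (Id \<X> X)"
  have eq: "base_change_comp g f X = induced P ?u ?h (Id \<B> (Cod \<B> g))"
    using assms by (simp add: base_change_comp_def associated_pseudofunctor_def push_Id)
  have u: "cocartesian P ?u" using assms by simp
  note i = induced_props[OF u, of ?h "Id \<B> (Cod \<B> g)"] induced_Comp[OF u, of ?h "Id \<B> (Cod \<B> g)"]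
  show "base_change_comp g f X \<in> Ar \<X>"
    "Dom \<X> (base_change_comp g f X) = FO (change_of_base P g) (FO (change_of_base P f) X)"
    "Cod \<X> (base_change_comp g f X) = FO (change_of_base P (g \<star> f)) X"
    "pA (base_change_comp g f X) = Id \<B> (Cod \<B> g)"
    unfolding eq using i(1-4) assms by simp_all
  show "base_change_comp g f X \<bullet> push g (push f a) = push (g \<star> f) a" if "a \<in> Ar \<X>" "Cod \<X> a = X"
    unfolding eq using i(6)[of a] that assms by simp
qed

text \<open>The monoidal constraint
  \<open>f_* X \<otimes> f_* Y \<rightarrow> f_* (X \<otimes> Y)\<close>. It can be vertical because
  \<open>f\<close> is a homomorphism of internal groups.\<close>

definition base_change_mul :: "'b \<Rightarrow> 'o \<Rightarrow> 'o \<Rightarrow> 'a" where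
  "base_change_mul f X Y = induced P
     (tensor_arr (Cod \<B> f) (push f (pr1 \<X> X Y)) (push f (pr2 \<X> X Y)))
     (push f (tensor_arr (Dom \<B> f) (pr1 \<X> X Y) (pr2 \<X> X Y)))
     (Id \<B> (Cod \<B> f))"

lemma base_change_mul [simp]:
  assumes ob: "f \<in> Ar \<B>" "X \<in> Ob \<X>" "Y \<in> Ob \<X>" "Dom \<B> f = A" "Cod \<B> f = A'" "pO X = A" "pO Y = A"
  shows "base_change_mul f X Y \<in> Ar \<X>"
    "Dom \<X> (base_change_mul f X Y) = FO (fibre_ten P A') (FO (change_of_base P f) X, FO (change_of_base P f) Y)"
    "Cod \<X> (base_change_mul f X Y) = FO (change_of_base P f) (FO (fibre_ten P A) (X, Y))"
    "pA (base_change_mul f X Y) = Id \<B> A'"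
    "\<lbrakk>a \<in> Ar \<X>; b \<in> Ar \<X>; Dom \<X> a = Dom \<X> b; Cod \<X> a = X; Cod \<X> b = Y\<rbrakk> \<Longrightarrow>
      base_change_mul f X Y \<bullet> tensor_arr A' (push f a) (push f b) = push f (tensor_arr A a b)"
proof -
  let ?u = "tensor_arr A' (push f (pr1 \<X> X Y)) (push f (pr2 \<X> X Y))" and ?h = "push f (tensor_arr A
    (pr1 \<X> X Y) (pr2 \<X> X Y))"
  have eq: "base_change_mul f X Y = induced P ?u ?h (Id \<B> A')"
    using assms by (simp add: base_change_mul_def)
  have A: "A \<in> Ob \<B>" "A' \<in> Ob \<B>" using assms by auto
  have "cocartesian P (gen_tensor A' (push f (Id \<X> X)) (push f (Id \<X> Y)))"
    using ob by simp
  then have u: "cocartesian P ?u" using assms by (simp add: gen_tensor_def)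
  note i = induced_props[OF u, of ?h "Id \<B> A'"] induced_Comp[OF u, of ?h "Id \<B> A'"]
  show "base_change_mul f X Y \<in> Ar \<X>"
    "Dom \<X> (base_change_mul f X Y) = FO (fibre_ten P A') (FO (change_of_base P f) X, FO (change_of_base P f) Y)"
    "Cod \<X> (base_change_mul f X Y) = FO (change_of_base P f) (FO (fibre_ten P A) (X, Y))"
    "pA (base_change_mul f X Y) = Id \<B> A'"
    unfolding eq using i(1-4) assms A by simp_all
  show "base_change_mul f X Y \<bullet> tensor_arr A' (push f a) (push f b) = push f (tensor_arr A a b)"
    if "a \<in> Ar \<X>" "b \<in> Ar \<X>" "Dom \<X> a = Dom \<X> b" "Cod \<X> a = X" "Cod \<X> b = Y"
    unfolding eq using i(6)[of "pair_arr \<X> a b"] that assms A by simp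
qed

text \<open>The unit constraint of \<open>f_*\<close>, vertical because \<open>f\<close> preserves
  zero.\<close>

definition base_change_unit :: "'b \<Rightarrow> 'a" where
  "base_change_unit f = induced P (unit_arr (Cod \<B> f) (One \<X>)) (push f (unit_arr (Dom \<B> f) (One \<X>))) (Id \<B>
    (Cod \<B> f))"

lemma base_change_unit [simp]:
  assumes ob: "f \<in> Ar \<B>" "Dom \<B> f = A" "Cod \<B> f = A'"
  shows "base_change_unit f \<in> Ar \<X>" "Dom \<X> (base_change_unit f) = fibre_unit P A'"
    "Cod \<X> (base_change_unit f) = FO (change_of_base P f) (fibre_unit P A)" "pA (base_change_unit f) = Id \<B> A'"
    "Z \<in> Ob \<X> \<Longrightarrow> base_change_unit f \<bullet> unit_arr A' Z = push f (unit_arr A Z)"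
proof -
  let ?u = "unit_arr A' (One \<X>)" and ?h = "push f (unit_arr A (One \<X>))"
  have A: "A \<in> Ob \<B>" "A' \<in> Ob \<B>" using assms by auto
  have eq: "base_change_unit f = induced P ?u ?h (Id \<B> A')"
    using assms by (simp add: base_change_unit_def)
  have u: "cocartesian P ?u" using A by simp
  note i = induced_props[OF u, of ?h "Id \<B> A'"] induced_Comp[OF u, of ?h "Id \<B> A'"]
  show "base_change_unit f \<in> Ar \<X>" "Dom \<X> (base_change_unit f) = fibre_unit P A'"
    "Cod \<X> (base_change_unit f) = FO (change_of_base P f) (fibre_unit P A)" "pA (base_change_unit f) = Id \<B> A'"
    unfolding eq using i(1-4) assms A by simp_all
  show "base_change_unit f \<bullet> unit_arr A' Z = push f (unit_arr A Z)" if "Z \<in> Ob \<X>"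
    unfolding eq using i(6)[of "terminal_map \<X> Z"] that assms A by simp
qed

section \<open>Functoriality of base change and tensor\<close>

lemma is_functor_change_of_base:
  assumes f: "f \<in> Hom \<B> A A'"
  shows "is_functor (fibre P A) (fibre P A') (change_of_base P f)"
proof -
  have [simp]: "f \<in> Ar \<B>" "Dom \<B> f = A" "Cod \<B> f = A'" using f by (auto simp: Hom_def)
  have A: "A \<in> Ob \<B>" "A' \<in> Ob \<B>"
    using bas.Dom_Cod_Ob[of f] by simp_all
  have 1: "FA (change_of_base P f) (Id \<X> X) = Id \<X> (FO (change_of_base P f) X)"
    if "X \<in> Ob \<X>" "pO X = A" for X
    by (rule cocartesian_cancel[of "push f (Id \<X> X)"]) (simp_all add: that)
  have 2: "FA (change_of_base P f) (w \<bullet> v) = FA (change_of_base P f) w \<bullet> FA (change_of_base P f) v"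
    if "v \<in> Ar (fibre P A)" "w \<in> Ar (fibre P A)" "Cod \<X> v = Dom \<X> w" for v w
    by (rule cocartesian_cancel[of "push f (Id \<X> (Dom \<X> v))"]) (use that A in simp_all)
  show ?thesis
    unfolding is_functor_def using A by (auto simp: Hom_def 1 2)
qed

lemma is_functor_fibre_ten:
  assumes A: "A \<in> Ob \<B>"
  shows "is_functor (prod_cat (fibre_sm P A) (fibre_sm P A)) (fibre_sm P A) (fibre_ten P A)"
proof -
  have 1: "FA (fibre_ten P A) (Id \<X> X, Id \<X> Y) = Id \<X> (FO (fibre_ten P A) (X, Y))"
    if "X \<in> Ob \<X>" "Y \<in> Ob \<X>" "pO X = A" "pO Y = A" for X Y
    \<comment> \<open>\<open>gen_tensor\<close> stays folded while cocartesianness and typing are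
      checked, and is unfolded only for the final equation of words.\<close>
    by (rule cocartesian_cancel[of "gen_tensor A (Id \<X> X) (Id \<X> Y)"])
      (simp_all add: that A, simp add: gen_tensor_def that A)
  have 2: "FA (fibre_ten P A) (w \<bullet> v, w' \<bullet> v') = FA (fibre_ten P A) (w, w') \<bullet> FA (fibre_ten P A) (v, v')"
    if "v \<in> Ar (fibre P A)" "w \<in> Ar (fibre P A)" "Cod \<X> v = Dom \<X> w"
      "v' \<in> Ar (fibre P A)" "w' \<in> Ar (fibre P A)" "Cod \<X> v' = Dom \<X> w'" for v w v' w'
    by (rule cocartesian_cancel[of "gen_tensor A (Id \<X> (Dom \<X> v)) (Id \<X> (Dom \<X> v'))"])
      (use that A in simp_all, use that A in \<open>simp add: gen_tensor_def\<close>)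
  show ?thesis
    unfolding is_functor_def using A by (auto simp: Hom_def 1 2 prod_cat_def)
qed

lemma pseudofunctor: "pseudofunctor_to_Cat \<B> (associated_pseudofunctor P)"
proof -
  have [simp]: "PObj (associated_pseudofunctor P) = fibre P" "PArr (associated_pseudofunctor P)
    = change_of_base P"
    "PComp (associated_pseudofunctor P) = base_change_comp" "PUnit (associated_pseudofunctor P) A = lift P
      (Id \<B> A)" for A
    by (auto simp: associated_pseudofunctor_def base_change_comp_def fun_eq_iff)
  let ?F = "associated_pseudofunctor P"
  show ?thesis
  proof (intro pseudofunctor_to_Cat.intro pseudofunctor_to_Cat_axioms.intro base_category)
    show "category (PObj ?F A)" if "A \<in> Ob \<B>" for A
      using category_fibre[OF that] by simp
    \<comment> \<open>A chosen lift over an identity is itself vertical, and its naturality is the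
      defining equation of base change along that identity.\<close>
    show "nat_iso (PObj ?F A) (PObj ?F A) id_functor (PArr ?F (Id \<B> A)) (PUnit ?F A)" if "A \<in> Ob \<B>" for A
      using that
      by (auto simp: nat_iso_def nat_trans_def id_functor_def Hom_def change_of_base_Ar(5) intro!: fibre_iso)
    show "is_functor (PObj ?F A) (PObj ?F A') (PArr ?F f)" if "f \<in> Hom \<B> A A'" for f A A'
      using is_functor_change_of_base[OF that] by simp
  next
    fix f g A A' A'' assume "f \<in> Hom \<B> A A'" "g \<in> Hom \<B> A' A''"
    then have f [simp]: "f \<in> Ar \<B>" "Dom \<B> f = A" "Cod \<B> f = A'" "g \<in> Ar \<B>" "Dom \<B> g = A'" "Cod \<B> g = A''"
      by (auto simp: Hom_def)
    have A: "A'' \<in> Ob \<B>" "A' \<in> Ob \<B>" "A \<in> Ob \<B>"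
      using bas.Dom_Cod_Ob[of f] bas.Dom_Cod_Ob[of g] by simp_all
    \<comment> \<open>Both sides send \<open>g_* (f_* x)\<close> to
      \<open>(g \<star> f)_* (v x)\<close>.\<close>
    have "base_change_comp g f (Cod \<X> v) \<bullet> (FA (change_of_base P g) (FA (change_of_base P f) v)) =
        FA (change_of_base P (g \<star> f)) v \<bullet> base_change_comp g f (Dom \<X> v)" if "v \<in> Ar (fibre P A)" for v
      by (rule cocartesian_cancel[of "push g (push f (Id \<X> (Dom \<X> v)))"]) (use that A in simp_all)
    then show "nat_iso (PObj ?F A) (PObj ?F A'') (comp_functor (PArr ?F g) (PArr ?F f))
        (PArr ?F (g \<star> f)) (PComp ?F g f)"
      using A by (auto simp: nat_iso_def nat_trans_def comp_functor_def Hom_def intro!: fibre_iso)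
  next
    fix f g h A A' A'' A''' X
    assume "f \<in> Hom \<B> A A'" "g \<in> Hom \<B> A' A''" "h \<in> Hom \<B> A'' A'''" and X: "X \<in> Ob (PObj ?F A)"
    then have f [simp]: "f \<in> Ar \<B>" "Dom \<B> f = A" "Cod \<B> f = A'" "g \<in> Ar \<B>" "Dom \<B> g = A'" "Cod \<B> g = A''"
      "h \<in> Ar \<B>" "Dom \<B> h = A''" "Cod \<B> h = A'''"
      by (auto simp: Hom_def)
    have A: "A'' \<in> Ob \<B>" "A' \<in> Ob \<B>" "A \<in> Ob \<B>" "A''' \<in> Ob \<B>"
      using bas.Dom_Cod_Ob[of f] bas.Dom_Cod_Ob[of g] bas.Dom_Cod_Ob[of h] by simp_all
    show "PComp ?F h (g \<star> f) X \<cdot>\<^bsub>PObj ?F A'''\<^esub> FA (PArr ?F h) (PComp ?F g f X) =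
        PComp ?F (h \<star> g) f X \<cdot>\<^bsub>PObj ?F A'''\<^esub> PComp ?F h g (FO (PArr ?F f) X)"
      by (rule cocartesian_cancel[of "push h (push g (push f (Id \<X> X)))"]) (use A X in simp_all)
  next
    fix f A A' X assume "f \<in> Hom \<B> A A'" and X: "X \<in> Ob (PObj ?F A)"
    then have f [simp]: "f \<in> Ar \<B>" "Dom \<B> f = A" "Cod \<B> f = A'"
      by (auto simp: Hom_def)
    have A: "A' \<in> Ob \<B>" "A \<in> Ob \<B>"
      using bas.Dom_Cod_Ob[of f] by simp_all
    show "PComp ?F f (Id \<B> A) X \<cdot>\<^bsub>PObj ?F A'\<^esub> FA (PArr ?F f) (PUnit ?F A X) =
        Id (PObj ?F A') (FO (PArr ?F f) X)"
      \<comment> \<open>The unit comparison is a chosen lift; reading it as \<open>push\<close> of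
        an identity lets it compute on words.\<close>
      by (rule cocartesian_cancel[of "push f (Id \<X> X)"]) (use A X in \<open>simp_all flip: push_Id\<close>)
    show "PComp ?F (Id \<B> A') f X \<cdot>\<^bsub>PObj ?F A'\<^esub> PUnit ?F A' (FO (PArr ?F f) X) =
        Id (PObj ?F A') (FO (PArr ?F f) X)"
      by (rule cocartesian_cancel[of "push f (Id \<X> X)"]) (use A X in \<open>simp_all flip: push_Id\<close>)
  qed
qed

section \<open>Symmetric 2-groups\<close>

text \<open>Each equation compares two vertical arrows out of a tensor product and is checked on the
  generic word bracketed like their domain.\<close>

lemma symmetric_monoidal_fibre:
  assumes A [simp]: "A \<in> Ob \<B>"
  shows "symmetric_monoidal_category (fibre_sm P A)"
proof -
  let ?M = "fibre_sm P A"
  note [simp] = Hom_def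
  show ?thesis
  proof (intro symmetric_monoidal_category.intro symmetric_monoidal_category_axioms.intro
      category_fibre is_functor_fibre_ten fibre_iso A)
    show "Asc ?M X' Y' Z' \<cdot>\<^bsub>?M\<^esub> tenA ?M (tenA ?M f g) h = tenA ?M f (tenA ?M g h) \<cdot>\<^bsub>?M\<^esub> Asc ?M X Y Z"
      if "f \<in> Hom ?M X X'" "g \<in> Hom ?M Y Y'" "h \<in> Hom ?M Z Z'" for f g h X X' Y Y' Z Z'
      by (rule cocartesian_cancel[of "gen_tensor A (gen_tensor A (Id \<X> X) (Id \<X> Y)) (Id \<X> Z)"])
        (use that in auto, simp add: gen_tensor_def)
    show "LUn ?M X' \<cdot>\<^bsub>?M\<^esub> tenA ?M (Id ?M (Unt ?M)) f = f \<cdot>\<^bsub>?M\<^esub> LUn ?M X"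
      if "f \<in> Hom ?M X X'" for f X X'
      by (rule cocartesian_cancel[of "gen_tensor A (unit_arr A (One \<X>)) (Id \<X> X)"])
        (use that in auto, simp add: gen_tensor_def)
    show "RUn ?M X' \<cdot>\<^bsub>?M\<^esub> tenA ?M f (Id ?M (Unt ?M)) = f \<cdot>\<^bsub>?M\<^esub> RUn ?M X"
      if "f \<in> Hom ?M X X'" for f X X'
      by (rule cocartesian_cancel[of "gen_tensor A (Id \<X> X) (unit_arr A (One \<X>))"])
        (use that in auto, simp add: gen_tensor_def)
    show "Sym ?M X' Y' \<cdot>\<^bsub>?M\<^esub> tenA ?M f g = tenA ?M g f \<cdot>\<^bsub>?M\<^esub> Sym ?M X Y"
      if "f \<in> Hom ?M X X'" "g \<in> Hom ?M Y Y'" for f g X X' Y Y'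
      by (rule cocartesian_cancel[of "gen_tensor A (Id \<X> X) (Id \<X> Y)"])
        (use that in auto, simp add: gen_tensor_def)
    \<comment> \<open>Both sides send \<open>((w x) y) z\<close> to
      \<open>w (x (y z))\<close>.\<close>
    show "Asc ?M W X (tenO ?M Y Z) \<cdot>\<^bsub>?M\<^esub> Asc ?M (tenO ?M W X) Y Z =
        tenA ?M (Id ?M W) (Asc ?M X Y Z) \<cdot>\<^bsub>?M\<^esub> Asc ?M W (tenO ?M X Y) Z \<cdot>\<^bsub>?M\<^esub> tenA ?M (Asc ?M W X Y) (Id ?M Z)"
      if "W \<in> Ob ?M" "X \<in> Ob ?M" "Y \<in> Ob ?M" "Z \<in> Ob ?M" for W X Y Z
      by (rule cocartesian_cancel[of "gen_tensor A (gen_tensor A (gen_tensor A (Id \<X> W) (Id \<X> X)) (Id \<X> Y))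
        (Id \<X> Z)"])
        (use that in auto, simp add: gen_tensor_def)
    show "tenA ?M (Id ?M X) (LUn ?M Y) \<cdot>\<^bsub>?M\<^esub> Asc ?M X (Unt ?M) Y = tenA ?M (RUn ?M X) (Id ?M Y)"
      if "X \<in> Ob ?M" "Y \<in> Ob ?M" for X Y
      by (rule cocartesian_cancel[of "gen_tensor A (gen_tensor A (Id \<X> X) (unit_arr A (One \<X>))) (Id \<X> Y)"])
        (use that in auto, simp add: gen_tensor_def)
    \<comment> \<open>Both sides send \<open>(x y) z\<close> to \<open>y (z x)\<close>.\<close>
    show "Asc ?M Y Z X \<cdot>\<^bsub>?M\<^esub> Sym ?M X (tenO ?M Y Z) \<cdot>\<^bsub>?M\<^esub> Asc ?M X Y Z =
        tenA ?M (Id ?M Y) (Sym ?M X Z) \<cdot>\<^bsub>?M\<^esub> Asc ?M Y X Z \<cdot>\<^bsub>?M\<^esub> tenA ?M (Sym ?M X Y) (Id ?M Z)"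
      if "X \<in> Ob ?M" "Y \<in> Ob ?M" "Z \<in> Ob ?M" for X Y Z
      by (rule cocartesian_cancel[of "gen_tensor A (gen_tensor A (Id \<X> X) (Id \<X> Y)) (Id \<X> Z)"])
        (use that in auto, simp add: gen_tensor_def)
    show "Sym ?M Y X \<cdot>\<^bsub>?M\<^esub> Sym ?M X Y = Id ?M (tenO ?M X Y)" if "X \<in> Ob ?M" "Y \<in> Ob ?M" for X Y
      by (rule cocartesian_cancel[of "gen_tensor A (Id \<X> X) (Id \<X> Y)"])
        (use that in auto, simp add: gen_tensor_def)
  qed (use is_functor_fibre_ten[OF A] in auto)
qed

lemma symmetric_2group_fibre:
  assumes A [simp]: "A \<in> Ob \<B>"
  shows "symmetric_2group (fibre_sm P A)"
proof (intro symmetric_2group.intro symmetric_2group_axioms.intro symmetric_monoidal_fibre A)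
  let ?M = "fibre_sm P A"
  show "is_iso ?M f" if "f \<in> Ar ?M" for f
    by (rule fibre_iso(2)) (use that in simp)
  show "\<exists>Y \<in> Ob ?M. isomorphic ?M (tenO ?M X Y) (Unt ?M) \<and> isomorphic ?M (tenO ?M Y X) (Unt ?M)"
    if "X \<in> Ob ?M" for X
  proof (intro bexI conjI)
    have X [simp]: "X \<in> Ob \<X>" "pO X = A" using that by auto
    let ?Y = "FO (change_of_base P (bas.neg A)) X" and ?n = "push (bas.neg A) (Id \<X> X)"
    show "?Y \<in> Ob ?M" by simp
    \<comment> \<open>The element \<open>x (-x)\<close> is the generic product of \<open>x\<close>
      and \<open>-x'\<close> restricted along the diagonal, hence cocartesian.\<close>
    have "cocartesian P (gen_tensor A (Id \<X> X) ?n \<bullet> pair_arr \<X> (Id \<X> X) (Id \<X> X))"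
      using cocartesian_diagonal[of X] by (intro cocartesian_Comp) simp_all
    then have u: "cocartesian P (tensor_arr A (Id \<X> X) ?n)" by (simp add: gen_tensor_def)
    have "cocartesian P (gen_tensor A ?n (Id \<X> X) \<bullet> pair_arr \<X> (Id \<X> X) (Id \<X> X))"
      using cocartesian_diagonal[of X] by (intro cocartesian_Comp) simp_all
    then have u': "cocartesian P (tensor_arr A ?n (Id \<X> X))" by (simp add: gen_tensor_def)
    have 1: "bas.add_arr A (Id \<B> A) (bas.neg A) = add_unit \<B> A \<star> terminal_map \<B> A"
      and 2: "bas.add_arr A (bas.neg A) (Id \<B> A) = add_unit \<B> A \<star> terminal_map \<B> A"
      using bas.add_arr_neg[of "Id \<B> A" A A] by simp_all
    \<comment> \<open>Both \<open>x (-x)\<close> and the unit at stage \<open>X\<close> lie over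
      zero, so the unit factors through the former by a vertical arrow, which is invertible.\<close>
    have "induced P (tensor_arr A (Id \<X> X) ?n) (unit_arr A X) (Id \<B> A) \<in> Hom ?M (tenO ?M X ?Y) (Unt ?M)"
      using induced_props[OF u, of "unit_arr A X" "Id \<B> A"] by (simp add: Hom_def 1)
    then show "isomorphic ?M (tenO ?M X ?Y) (Unt ?M)"
      unfolding isomorphic_def by (auto simp: Hom_def intro!: bexI fibre_iso)
    have "induced P (tensor_arr A ?n (Id \<X> X)) (unit_arr A X) (Id \<B> A) \<in> Hom ?M (tenO ?M ?Y X) (Unt ?M)"
      using induced_props[OF u', of "unit_arr A X" "Id \<B> A"] by (simp add: Hom_def 2)
    then show "isomorphic ?M (tenO ?M ?Y X) (Unt ?M)"
      unfolding isomorphic_def by (auto simp: Hom_def intro!: bexI fibre_iso)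
  qed
qed

text \<open>The comparison cells are those of the associated pseudofunctor; only monoidal
  constraints are added, so forgetting them returns the original data on the nose.\<close>

definition sym2gp_pseudofunctor :: "('p, 'b, 'o, 'a) sym2gp_psf" where
  "sym2gp_pseudofunctor =
     \<lparr>SObj = fibre_sm P,
      SArr = (\<lambda>f. \<lparr>FO = FO (change_of_base P f), FA = FA (change_of_base P f), Mul = base_change_mul f, Mun
        = base_change_unit f\<rparr>),
      SComp = base_change_comp, SUnit = PUnit (associated_pseudofunctor P)\<rparr>"

lemma forget_sym2gp_pseudofunctor:
  "forget_sym2gp sym2gp_pseudofunctor = associated_pseudofunctor P"
  by (simp add: forget_sym2gp_def sym2gp_pseudofunctor_def functor_data.defs base_change_comp_def fun_eq_iff
      associated_pseudofunctor_def)

text \<open>The axioms are tested on words in pushed elements. For associativity, both sides send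
  \<open>(f_* x f_* y) f_* z\<close> to \<open>f_* (x (y z))\<close>.\<close>

lemma symmetric_monoidal_change_of_base:
  assumes "f \<in> Hom \<B> A A'"
  shows "symmetric_monoidal_functor (fibre_sm P A) (fibre_sm P A') (SArr sym2gp_pseudofunctor f)"
proof -
  let ?F = "SArr sym2gp_pseudofunctor f"
  have [simp]: "f \<in> Ar \<B>" "Dom \<B> f = A" "Cod \<B> f = A'" using assms by (auto simp: Hom_def)
  have A [simp]: "A \<in> Ob \<B>" "A' \<in> Ob \<B>"
    using bas.Dom_Cod_Ob[of f] by simp_all
  have [simp]: "FO ?F = FO (change_of_base P f)" "FA ?F = FA (change_of_base P f)" "Mul ?F
    = base_change_mul f" "Mun ?F = base_change_unit f"
    by (simp_all add: sym2gp_pseudofunctor_def)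
  have "is_functor (fibre_sm P A) (fibre_sm P A') ?F"
    using is_functor_change_of_base[OF assms] by (simp add: is_functor_def Hom_def)
  moreover have "base_change_mul f (Cod \<X> v) (Cod \<X> w) \<bullet>
      FA (fibre_ten P A') (FA (change_of_base P f) v, FA (change_of_base P f) w) =
      FA (change_of_base P f) (FA (fibre_ten P A) (v, w)) \<bullet> base_change_mul f (Dom \<X> v) (Dom \<X> w)"
    if "v \<in> Ar (fibre P A)" "w \<in> Ar (fibre P A)" for v w
    by (rule cocartesian_cancel[of "gen_tensor A' (push f (Id \<X> (Dom \<X> v))) (push f (Id \<X> (Dom \<X> w)))"])
      (use that in simp_all, use that in \<open>simp add: gen_tensor_def\<close>)
  moreover have "(FA (change_of_base P f) (fibre_assoc P A X Y Z) \<bullet> base_change_mul f (FO (fibre_ten P A)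
    (X, Y)) Z) \<bullet>
        FA (fibre_ten P A') (base_change_mul f X Y, Id \<X> (FO (change_of_base P f) Z)) =
      (base_change_mul f X (FO (fibre_ten P A) (Y, Z)) \<bullet> FA (fibre_ten P A') (Id \<X> (FO
        (change_of_base P f) X), base_change_mul f Y Z)) \<bullet>
        fibre_assoc P A' (FO (change_of_base P f) X) (FO (change_of_base P f) Y) (FO (change_of_base P f) Z)"
    if "X \<in> Ob (fibre P A)" "Y \<in> Ob (fibre P A)" "Z \<in> Ob (fibre P A)" for X Y Z
    by (rule cocartesian_cancel[of "gen_tensor A' (gen_tensor A' (push f (Id \<X> X)) (push f (Id \<X> Y)))
      (push f (Id \<X> Z))"])
      (use that in simp_all, use that in \<open>simp add: gen_tensor_def\<close>)
  moreover have "(FA (change_of_base P f) (fibre_lunit P A X) \<bullet> base_change_mul f (fibre_unit P A) X) \<bullet>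
        FA (fibre_ten P A') (base_change_unit f, Id \<X> (FO (change_of_base P f) X)) = fibre_lunit P A' (FO
          (change_of_base P f) X)"
    if "X \<in> Ob (fibre P A)" for X
    by (rule cocartesian_cancel[of "gen_tensor A' (unit_arr A' (One \<X>)) (push f (Id \<X> X))"])
      (use that in simp_all, use that in \<open>simp add: gen_tensor_def\<close>)
  moreover have "(FA (change_of_base P f) (fibre_runit P A X) \<bullet> base_change_mul f X (fibre_unit P A)) \<bullet>
        FA (fibre_ten P A') (Id \<X> (FO (change_of_base P f) X), base_change_unit f) = fibre_runit P A' (FO
          (change_of_base P f) X)"
    if "X \<in> Ob (fibre P A)" for X
    by (rule cocartesian_cancel[of "gen_tensor A' (push f (Id \<X> X)) (unit_arr A' (One \<X>))"])
      (use that in simp_all, use that in \<open>simp add: gen_tensor_def\<close>)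
  moreover have "FA (change_of_base P f) (fibre_sym P A X Y) \<bullet> base_change_mul f X Y =
      base_change_mul f Y X \<bullet> fibre_sym P A' (FO (change_of_base P f) X) (FO (change_of_base P f) Y)"
    if "X \<in> Ob (fibre P A)" "Y \<in> Ob (fibre P A)" for X Y
    by (rule cocartesian_cancel[of "gen_tensor A' (push f (Id \<X> X)) (push f (Id \<X> Y))"])
      (use that in simp_all, use that in \<open>simp add: gen_tensor_def\<close>)
  ultimately show ?thesis
    unfolding symmetric_monoidal_functor_def
    by (simp add: Hom_def fibre_iso)
qed

lemma pseudofunctor_to_Sym2Gp: "pseudofunctor_to_Sym2Gp \<B> sym2gp_pseudofunctor"
proof (intro pseudofunctor_to_Sym2Gp.intro)
  show "pseudofunctor_to_Cat \<B> (forget_sym2gp sym2gp_pseudofunctor)"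
    by (simp add: forget_sym2gp_pseudofunctor pseudofunctor)
  have [simp]: "SObj sym2gp_pseudofunctor = fibre_sm P" "SComp sym2gp_pseudofunctor = base_change_comp"
    "SUnit sym2gp_pseudofunctor A = lift P (Id \<B> A)" for A
    by (auto simp: sym2gp_pseudofunctor_def associated_pseudofunctor_def)
  have [simp]: "FO (SArr sym2gp_pseudofunctor f) = FO (change_of_base P f)"
    "FA (SArr sym2gp_pseudofunctor f) = FA (change_of_base P f)"
    "Mul (SArr sym2gp_pseudofunctor f) = base_change_mul f" "Mun (SArr sym2gp_pseudofunctor f)
      = base_change_unit f" for f
    by (simp_all add: sym2gp_pseudofunctor_def)
  show "symmetric_2group (SObj sym2gp_pseudofunctor A)" if "A \<in> Ob \<B>" for A
    using that by (simp add: symmetric_2group_fibre)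
  show "symmetric_monoidal_functor (SObj sym2gp_pseudofunctor A) (SObj sym2gp_pseudofunctor A')
    (SArr sym2gp_pseudofunctor f)"
    if "f \<in> Hom \<B> A A'" for f A A'
    using symmetric_monoidal_change_of_base[OF that] by simp
  show "monoidal_nat_trans (SObj sym2gp_pseudofunctor A) (SObj sym2gp_pseudofunctor A'')
      (comp_sm_functor (SObj sym2gp_pseudofunctor A'') (SArr sym2gp_pseudofunctor g)
        (SArr sym2gp_pseudofunctor f))
      (SArr sym2gp_pseudofunctor (g \<star> f)) (SComp sym2gp_pseudofunctor g f)"
    if fg: "f \<in> Hom \<B> A A'" "g \<in> Hom \<B> A' A''" for f g A A' A''
  proof -
    have [simp]: "f \<in> Ar \<B>" "Dom \<B> f = A" "Cod \<B> f = A'" "g \<in> Ar \<B>" "Dom \<B> g = A'" "Cod \<B> g = A''"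
      using fg by (auto simp: Hom_def)
    have [simp]: "A'' \<in> Ob \<B>" "A' \<in> Ob \<B>" "A \<in> Ob \<B>"
      using bas.Dom_Cod_Ob[of f] bas.Dom_Cod_Ob[of g] by simp_all
    interpret pseudofunctor_to_Cat \<B> "associated_pseudofunctor P" by (rule pseudofunctor)
    \<comment> \<open>Naturality concerns only the underlying functors, so it is inherited from the
      pseudofunctor into categories.\<close>
    have "nat_trans (fibre_sm P A) (fibre_sm P A'')
        (comp_sm_functor (fibre_sm P A'') (SArr sym2gp_pseudofunctor g) (SArr sym2gp_pseudofunctor f))
        (SArr sym2gp_pseudofunctor (g \<star> f)) (base_change_comp g f)"
      using PComp_nat_iso[OF fg]
      by (simp add: nat_iso_def nat_trans_def comp_functor_def comp_sm_functor_def base_change_comp_def Hom_def)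
        (simp add: associated_pseudofunctor_def)
    \<comment> \<open>Both sides send the product of \<open>g_* (f_* x)\<close> and
      \<open>g_* (f_* y)\<close> to \<open>(g \<star> f)_* (x y)\<close>.\<close>
    moreover have "base_change_comp g f (FO (fibre_ten P A) (X, Y)) \<bullet> FA (change_of_base P g)
      (base_change_mul f X Y) \<bullet>
          base_change_mul g (FO (change_of_base P f) X) (FO (change_of_base P f) Y) =
        base_change_mul (g \<star> f) X Y \<bullet> FA (fibre_ten P A'') (base_change_comp g f X, base_change_comp g f Y)"
      if "X \<in> Ob (fibre P A)" "Y \<in> Ob (fibre P A)" for X Y
      by (rule cocartesian_cancel[of "gen_tensor A'' (push g (push f (Id \<X> X))) (push g (push f (Id \<X> Y)))"])
        (use that in simp_all, use that in \<open>simp add: gen_tensor_def\<close>)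
    moreover have "base_change_comp g f (fibre_unit P A) \<bullet> FA (change_of_base P g) (base_change_unit f)
      \<bullet> base_change_unit g = base_change_unit (g \<star> f)"
      by (rule cocartesian_cancel[of "unit_arr A'' (One \<X>)"]) simp_all
    ultimately show ?thesis
      by (simp add: monoidal_nat_trans_def comp_sm_functor_def)
  qed
  show "monoidal_nat_trans (SObj sym2gp_pseudofunctor A) (SObj sym2gp_pseudofunctor A)
      (id_sm_functor (SObj sym2gp_pseudofunctor A)) (SArr sym2gp_pseudofunctor (Id \<B> A))
        (SUnit sym2gp_pseudofunctor A)"
    if A [simp]: "A \<in> Ob \<B>" for A
  proof -
    interpret pseudofunctor_to_Cat \<B> "associated_pseudofunctor P" by (rule pseudofunctor)
    have "nat_trans (fibre_sm P A) (fibre_sm P A) (id_sm_functor (fibre_sm P A))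
        (SArr sym2gp_pseudofunctor (Id \<B> A)) (lift P (Id \<B> A))"
      using PUnit_nat_iso[OF A]
      by (simp add: nat_iso_def nat_trans_def id_functor_def id_sm_functor_def Hom_def)
        (simp add: associated_pseudofunctor_def)
    \<comment> \<open>Both sides send \<open>x y\<close> to its image under base change along the
      identity.\<close>
    moreover have "lift P (Id \<B> A) (FO (fibre_ten P A) (X, Y)) =
        base_change_mul (Id \<B> A) X Y \<bullet> FA (fibre_ten P A) (lift P (Id \<B> A) X, lift P (Id \<B> A) Y)"
      if "X \<in> Ob (fibre P A)" "Y \<in> Ob (fibre P A)" for X Y
      by (rule cocartesian_cancel[of "gen_tensor A (Id \<X> X) (Id \<X> Y)"])
        (use that in simp_all, use that in \<open>simp add: gen_tensor_def flip: push_Id\<close>)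
    moreover have "lift P (Id \<B> A) (fibre_unit P A) = base_change_unit (Id \<B> A)"
      by (rule cocartesian_cancel[of "unit_arr A (One \<X>)"]) simp_all
    ultimately show ?thesis
      by (simp add: monoidal_nat_trans_def id_sm_functor_def)
  qed
qed

end

theorem theorem5p8:
  fixes P :: "('o, 'a, 'p, 'b) opfib"
  assumes "cartesian_monoidal_opfibration P"
    and "additive_category (base P)"
    and "\<And>X. X \<in> Ob (total P) \<Longrightarrow> cocartesian P (terminal_map (total P) X)"
    and "\<And>X. X \<in> Ob (total P) \<Longrightarrow> cocartesian P (diagonal_map (total P) X)"
  shows "factors_through_Sym2Gp P"
proof -
  \<comment> \<open>The hom-group structure furnished by additivity becomes the parameter
    \<open>ab\<close> of the locale.\<close>
  obtain ab where ab: "preadditive_structure (base P) ab"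
    using assms(2) by (auto simp: additive_category_def)
  interpret additive_opfibration P ab
    using assms ab by (simp add: additive_opfibration_def additive_opfibration_axioms_def)
  show ?thesis
    unfolding factors_through_Sym2Gp_def
    using pseudofunctor_to_Sym2Gp forget_sym2gp_pseudofunctor
    by (intro exI[of _ sym2gp_pseudofunctor]) (simp add: sym2gp_pseudofunctor_def)
qed

end
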